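(* Let $X\subseteq\mathbb{R}^d$ be bounded and $\theta\in(0,1]$. Then $\underline{\dim}_{\theta}X=\underline{\dim}_{\theta}^{d}X$ and $\overline{\dim}_{\theta}X=\overline{\dim}_{\theta}^{d}X$.
   Context: Intermediate dimensions: for $X\subseteq\mathbb{R}^d$ and $0<\theta\leq1$, $\underline{\dim}_\theta X$ is the infimum of $s\geq0$ such that for all $\epsilon>0$ and all $r_0>0$ there exist $0<r\leq r_0$ and a cover $\{U_i\}$ of $X$ with $r^{1/\theta}\leq|U_i|\leq r$ and $\sum_i|U_i|^s\leq\epsilon$; $\overline{\dim}_\theta X$ is the infimum of $s\geq0$ such that for all $\epsilon>0$ there is $r_0>0$ such that for all $0<r\leq r_0$ there is a cover $\{U_i\}$ of $X$ with $r^{1/\theta}\leq|U_i|\leq r$ and $\sum_i|U_i|^s\leq\epsilon$ ($|U|$ denotes diameter). Intermediate dimension profiles: for integer $1\leq k\leq d$, $0\leq s\leq k$, $0<r\leq1$, define on $\mathbb{R}^d$ the kernel $\phi_{r,\theta}^{s,k}(x)=1$ if $|x|<r$, $=(r/|x|)^s$ if $r\leq|x|<r^\theta$, and $=r^{\theta(k-s)+s}/|x|^k$ if $r^\theta\leq|x|$. For compact $X$, the capacity is $C_{r,\theta}^{s,k}(X)=\big(\inf_\mu\iint\phi_{r,\theta}^{s,k}(x-y)\,d\mu(x)\,d\mu(y)\big)^{-1}$, the infimum over Borel probability measures $\mu$ supported on $X$; for bounded $X$ use the closure. The lower (resp. upper) intermediate dimension profile $\underline{\dim}_\theta^kX$ (resp.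 $\overline{\dim}_\theta^kX$) is the unique $s\in[0,k]$ with $\liminf_{r\to0}\frac{\log C_{r,\theta}^{s,k}(X)}{-\log r}=s$ (resp. $\limsup_{r\to0}\frac{\log C^{s,k}_{r,\theta}(X)}{-\log r}=s$); such $s$ exists and is unique. *)

theory Defs
  imports "HOL-Analysis.Analysis" "HOL-Probability.Probability"
begin

definition int_cover ::
  "'a::euclidean_space set \<Rightarrow> real \<Rightarrow> real \<Rightarrow> real \<Rightarrow> real \<Rightarrow> 'a set set \<Rightarrow> bool" where
  "int_cover X \<theta> r s \<epsilon> U \<longleftrightarrow>
     countable U \<and> X \<subseteq> \<Union>U \<and>
     (\<forall>u\<in>U. r powr (1/\<theta>) \<le> diameter u \<and> diameter u \<le> r) \<and>
     (\<lambda>u. diameter u powr s) summable_on U \<and>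
     (\<Sum>\<^sub>\<infinity>u\<in>U. diameter u powr s) \<le> \<epsilon>"

definition lower_int_dim :: "real \<Rightarrow> 'a::euclidean_space set \<Rightarrow> real" where
  "lower_int_dim \<theta> X = Inf {s. s \<ge> 0 \<and>
     (\<forall>\<epsilon>>0. \<forall>r0>0. \<exists>r. 0 < r \<and> r \<le> r0 \<and> (\<exists>U. int_cover X \<theta> r s \<epsilon> U))}"

definition upper_int_dim :: "real \<Rightarrow> 'a::euclidean_space set \<Rightarrow> real" where
  "upper_int_dim \<theta> X = Inf {s. s \<ge> 0 \<and>
     (\<forall>\<epsilon>>0. \<exists>r0>0. \<forall>r. 0 < r \<and> r \<le> r0 \<longrightarrow> (\<exists>U. int_cover X \<theta> r s \<epsilon> U))}"

definition phi_kernel :: "real \<Rightarrow> real \<Rightarrow> real \<Rightarrow> nat \<Rightarrow> 'a::euclidean_space \<Rightarrow> real" where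
  "phi_kernel r \<theta> s k x =
     (if norm x < r then 1
      else if norm x < r powr \<theta> then (r / norm x) powr s
      else r powr (\<theta> * (real k - s) + s) / norm x ^ k)"

definition supp_prob_measures :: "'a::euclidean_space set \<Rightarrow> 'a measure set" where
  "supp_prob_measures X = {\<mu>. prob_space \<mu> \<and> sets \<mu> = sets borel \<and>
                               emeasure \<mu> (- closure X) = 0}"

definition energy :: "real \<Rightarrow> real \<Rightarrow> real \<Rightarrow> nat \<Rightarrow> 'a::euclidean_space measure \<Rightarrow> ennreal" where
  "energy r \<theta> s k \<mu> =
     (\<integral>\<^sup>+ x. (\<integral>\<^sup>+ y. ennreal (phi_kernel r \<theta> s k (x - y)) \<partial>\<mu>) \<partial>\<mu>)"

definition capacity :: "real \<Rightarrow> real \<Rightarrow> real \<Rightarrow> nat \<Rightarrow> 'a::euclidean_space set \<Rightarrow> real" where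
  "capacity r \<theta> s k X =
     inverse (enn2real (INF \<mu>\<in>supp_prob_measures X. energy r \<theta> s k \<mu>))"

definition lower_profile :: "real \<Rightarrow> nat \<Rightarrow> 'a::euclidean_space set \<Rightarrow> real" where
  "lower_profile \<theta> k X = (THE s. 0 \<le> s \<and> s \<le> real k \<and>
     Liminf (at_right 0) (\<lambda>r. ereal (ln (capacity r \<theta> s k X) / - ln r)) = ereal s)"

definition upper_profile :: "real \<Rightarrow> nat \<Rightarrow> 'a::euclidean_space set \<Rightarrow> real" where
  "upper_profile \<theta> k X = (THE s. 0 \<le> s \<and> s \<le> real k \<and>
     Limsup (at_right 0) (\<lambda>r. ereal (ln (capacity r \<theta> s k X) / - ln r)) = ereal s)"

end

theory Submission
  imports Defs "HOL-Real_Asymp.Real_Asymp"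
begin

text \<open>
  With \<open>\<delta> = r powr (1 / \<theta>)\<close>, the admissible diameters are those in \<open>[\<delta>, \<delta> powr \<theta>]\<close>. For a
  cover \<open>U\<close> by such sets, Cauchy--Schwarz shows that every probability measure on \<open>X\<close> has energy
  at least \<open>\<delta> powr s\<close> divided by the sum of \<open>diameter u powr s\<close>. Conversely, a Frostman
  construction on a dyadic grid yields a cover and a finitely supported measure of total mass \<open>M\<close>,
  where \<open>M\<close> dominates the sum over the cover, whose normalisation has energy at most a constant
  times the number of dyadic scales times \<open>\<delta> powr s / M\<close>. The number of scales is logarithmic in
  \<open>1 / \<delta>\<close>, so up to \<open>o(1)\<close> the exponents of the capacity and of the optimal covering sum differ by
  \<open>s\<close>. Comparing kernels for different \<open>s\<close> shows that the limit of the capacity exponent is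
  nondecreasing in \<open>s\<close> with Lipschitz constant \<open>1 - \<theta> < 1\<close>; hence its fixed point is unique, and it
  is the critical value of the covering sums.
\<close>

subsection \<open>Dyadic grids\<close>

text \<open>Labels are cut off outside \<open>Basis\<close>, so equal labels mean equal integer
  coordinates and the labels of nearby points lie in a finite \<open>PiE\<close>.\<close>

definition grid_cell :: "real \<Rightarrow> 'a::euclidean_space \<Rightarrow> 'a \<Rightarrow> int" where
  "grid_cell h x = restrict (\<lambda>b. \<lfloor>x \<bullet> b / h\<rfloor>) Basis"

lemma grid_cell_eq_iff:
  "grid_cell h x = grid_cell h y \<longleftrightarrow> (\<forall>b\<in>Basis. \<lfloor>x \<bullet> b / h\<rfloor> = \<lfloor>y \<bullet> b / h\<rfloor>)"
  by (auto simp: grid_cell_def fun_eq_iff restrict_def)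

lemma dist_le_if_grid_cell_eq:
  fixes x y :: "'a::euclidean_space" and h :: real
  assumes "h > 0" "grid_cell h x = grid_cell h y"
  shows "dist x y \<le> DIM('a) * h"
proof -
  have "\<bar>(x - y) \<bullet> b\<bar> \<le> h" if "b \<in> Basis" for b
  proof -
    have "\<lfloor>x \<bullet> b / h\<rfloor> = \<lfloor>y \<bullet> b / h\<rfloor>"
      using assms that by (auto simp: grid_cell_eq_iff)
    hence "\<bar>x \<bullet> b / h - y \<bullet> b / h\<bar> \<le> 1" by linarith
    hence "\<bar>(x - y) \<bullet> b / h\<bar> \<le> 1" by (simp add: inner_diff_left diff_divide_distrib)
    thus ?thesis using assms(1) by (simp add: abs_divide field_simps)
  qed
  hence "(\<Sum>b\<in>Basis. \<bar>(x - y) \<bullet> b\<bar>) \<le> DIM('a) * h"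
    using sum_bounded_above[of Basis "\<lambda>b. \<bar>(x - y) \<bullet> b\<bar>" h] by simp
  thus ?thesis using norm_le_l1[of "x - y"] by (simp add: dist_norm)
qed

text \<open>The floor of \<open>t / (2 * h)\<close> is determined by the floor of
  \<open>t / h\<close>, so coarse labels are functions of fine ones. This makes the grids of mesh
  \<open>2 ^ j * h\<close> a tree.\<close>

lemma grid_cell_double_eq:
  assumes "grid_cell h x = grid_cell h y"
  shows "grid_cell (2 * h) x = grid_cell (2 * h) y"
proof -
  have "\<lfloor>t / (2 * h)\<rfloor> = \<lfloor>t / h\<rfloor> div 2" for t
    using floor_divide_real_eq_div[of 2 "t / h"] by (simp add: field_simps)
  thus ?thesis using assms by (simp add: grid_cell_eq_iff)
qed

text \<open>Along each basis vector the label stays within \<open>L\<close> of that of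
  \<open>x\<close>, which leaves \<open>2 * L + 1\<close> integers.\<close>

lemma card_grid_cells_le:
  fixes S :: "'a::euclidean_space set"
  assumes "h > 0" and near: "\<And>y. y \<in> S \<Longrightarrow> dist x y \<le> real L * h"
  shows "finite (grid_cell h ` S)" "card (grid_cell h ` S) \<le> (2 * L + 1) ^ DIM('a)"
proof -
  let ?Q = "PiE Basis (\<lambda>b. {\<lfloor>x \<bullet> b / h\<rfloor> - int L .. \<lfloor>x \<bullet> b / h\<rfloor> + int L})"
  have sub: "grid_cell h ` S \<subseteq> ?Q"
  proof (intro image_subsetI PiE_I)
    fix y b :: 'a assume "y \<in> S" "b \<in> Basis"
    hence "\<bar>(x - y) \<bullet> b\<bar> \<le> real L * h"
      using near[of y] Basis_le_norm[of b "x - y"] by (simp add: dist_norm)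
    hence "\<bar>(x - y) \<bullet> b\<bar> / h \<le> real L" using assms(1) by (simp add: field_simps)
    hence "\<bar>x \<bullet> b / h - y \<bullet> b / h\<bar> \<le> real L"
      using assms(1) by (simp add: inner_diff_left diff_divide_distrib[symmetric] abs_divide)
    hence "\<lfloor>y \<bullet> b / h\<rfloor> \<le> \<lfloor>x \<bullet> b / h\<rfloor> + int L" "\<lfloor>x \<bullet> b / h\<rfloor> - int L \<le> \<lfloor>y \<bullet> b / h\<rfloor>"
      by linarith+
    thus "grid_cell h y b \<in> {\<lfloor>x \<bullet> b / h\<rfloor> - int L .. \<lfloor>x \<bullet> b / h\<rfloor> + int L}"
      using \<open>b \<in> Basis\<close> by (simp add: grid_cell_def)
  qed (simp add: grid_cell_def)
  have fin: "finite ?Q" by (intro finite_PiE) auto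
  have "card ?Q = (2 * L + 1) ^ DIM('a)"
    by (simp add: card_PiE nat_add_distrib nat_mult_distrib algebra_simps)
  thus "card (grid_cell h ` S) \<le> (2 * L + 1) ^ DIM('a)"
    using card_mono[OF fin sub] by simp
  show "finite (grid_cell h ` S)" using fin sub finite_subset by blast
qed

subsection \<open>Frostman weights on a tree\<close>

text \<open>Going up the levels, overfull cells are rescaled to be exactly full: a point either has a
  full cell on the new level or keeps its old one.\<close>

lemma dyadic_frostman_weights:
  fixes q :: "nat \<Rightarrow> 'p \<Rightarrow> 'c" and m :: "nat \<Rightarrow> real"
  assumes "finite P" "inj_on (q 0) P" "\<And>j. m j > 0"
    and nested: "\<And>j x y. q j x = q j y \<Longrightarrow> q (Suc j) x = q (Suc j) y"
  shows "\<exists>w. (\<forall>p\<in>P. 0 \<le> w p)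
    \<and> (\<forall>j\<le>J. \<forall>x\<in>P. (\<Sum>y | y \<in> P \<and> q j y = q j x. w y) \<le> m j)
    \<and> (\<forall>x\<in>P. \<exists>j\<le>J. (\<Sum>y | y \<in> P \<and> q j y = q j x. w y) = m j)"
proof (induction J)
  case 0
  have "{y \<in> P. q 0 y = q 0 x} = {x}" if "x \<in> P" for x
    using assms(2) that by (auto simp: inj_on_def)
  thus ?case using assms(3)[of 0] by (intro exI[of _ "\<lambda>_. m 0"]) auto
next
  case (Suc J)
  then obtain w where w0: "\<And>p. p \<in> P \<Longrightarrow> 0 \<le> w p"
    and wle: "\<And>j x. j \<le> J \<Longrightarrow> x \<in> P \<Longrightarrow> (\<Sum>y | y \<in> P \<and> q j y = q j x. w y) \<le> m j"
    and weq: "\<And>x. x \<in> P \<Longrightarrow> \<exists>j\<le>J. (\<Sum>y | y \<in> P \<and> q j y = q j x. w y) = m j"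
    by blast
  define T where "T x = (\<Sum>y | y \<in> P \<and> q (Suc J) y = q (Suc J) x. w y)" for x
  define c where "c x = (if T x > m (Suc J) then m (Suc J) / T x else 1)" for x
  have c01: "0 \<le> c x" "c x \<le> 1" for x
    using assms(3)[of "Suc J"] by (auto simp: c_def field_simps)
  have nested': "q k x = q k y" if "q j x = q j y" "j \<le> k" for j k x y
    using that(2) by (induction rule: dec_induct) (auto intro: nested that)
  have ccong: "c y = c x" if "q (Suc J) y = q (Suc J) x" for x y
    using that by (simp add: c_def T_def)
  \<comment> \<open>A cell of level at most \<open>Suc J\<close> lies in a single cell of level
    \<open>Suc J\<close>, on which \<open>c\<close> is constant, so its mass is multiplied by one
    factor.\<close>
  have scale: "(\<Sum>y | y \<in> P \<and> q j y = q j x. c y * w y)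
      = c x * (\<Sum>y | y \<in> P \<and> q j y = q j x. w y)" if "j \<le> Suc J" for j x
    unfolding sum_distrib_left using that by (intro sum.cong) (auto dest: nested' ccong)
  have cT: "c x * T x = min (T x) (m (Suc J))" for x
    using assms(3)[of "Suc J"] by (auto simp: c_def min_def)
  show ?case
  proof (intro exI[of _ "\<lambda>y. c y * w y"] conjI ballI allI impI)
    fix p assume "p \<in> P" thus "0 \<le> c p * w p" using c01 w0 by simp
  next
    fix j x assume j: "j \<le> Suc J" and x: "x \<in> P"
    have nn: "0 \<le> (\<Sum>y | y \<in> P \<and> q j y = q j x. w y)" by (intro sum_nonneg) (auto simp: w0)
    show "(\<Sum>y | y \<in> P \<and> q j y = q j x. c y * w y) \<le> m j"
    proof (cases "j = Suc J")
      case True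
      thus ?thesis using scale[of "Suc J" x] cT[of x] by (simp add: T_def)
    next
      case False
      thus ?thesis using scale[OF j, of x] wle[of j x] x j c01[of x] nn
          mult_right_mono[OF c01(2)[of x] nn] by simp
    qed
  next
    fix x assume x: "x \<in> P"
    show "\<exists>j\<le>Suc J. (\<Sum>y | y \<in> P \<and> q j y = q j x. c y * w y) = m j"
    proof (cases "T x > m (Suc J)")
      case True
      thus ?thesis using scale[of "Suc J" x] cT[of x]
        by (intro exI[of _ "Suc J"]) (simp add: T_def)
    next
      case False
      obtain j where "j \<le> J" "(\<Sum>y | y \<in> P \<and> q j y = q j x. w y) = m j" using weq x by blast
      thus ?thesis using False scale[of j x] by (intro exI[of _ j]) (simp add: c_def)
    qed
  qed
qed

text \<open>Every point is assigned its largest full cell. Two such cells that meet are nested, and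
  maximality makes them equal. Hence they partition \<open>P\<close>, and their prescribed masses
  add up to the total mass.\<close>

lemma dyadic_frostman:
  fixes q :: "nat \<Rightarrow> 'p \<Rightarrow> 'c" and m :: "nat \<Rightarrow> real"
  assumes "finite P" "inj_on (q 0) P" "\<And>j. m j > 0"
    and nested: "\<And>j x y. q j x = q j y \<Longrightarrow> q (Suc j) x = q (Suc j) y"
  obtains w l R where "\<And>p. p \<in> P \<Longrightarrow> 0 \<le> w p"
    "\<And>j x. j \<le> J \<Longrightarrow> x \<in> P \<Longrightarrow> (\<Sum>y | y \<in> P \<and> q j y = q j x. w y) \<le> m j"
    "R \<subseteq> P" "\<And>x. x \<in> R \<Longrightarrow> l x \<le> J" "\<And>p. p \<in> P \<Longrightarrow> \<exists>x\<in>R. q (l x) p = q (l x) x"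
    "(\<Sum>x\<in>R. m (l x)) = (\<Sum>p\<in>P. w p)"
proof -
  obtain w where
    w0: "\<And>p. p \<in> P \<Longrightarrow> 0 \<le> w p"
    and wle: "\<And>j x. j \<le> J \<Longrightarrow> x \<in> P \<Longrightarrow> (\<Sum>y | y \<in> P \<and> q j y = q j x. w y) \<le> m j"
    and weq: "\<And>x. x \<in> P \<Longrightarrow> \<exists>j\<le>J. (\<Sum>y | y \<in> P \<and> q j y = q j x. w y) = m j"
    using dyadic_frostman_weights[of P q m J, OF assms] by blast
  define sat where "sat x j \<longleftrightarrow> j \<le> J \<and> (\<Sum>y | y \<in> P \<and> q j y = q j x. w y) = m j" for x j
  define l where "l x = (GREATEST j. sat x j)" for x
  have sat_l: "sat x (l x)" if "x \<in> P" for x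
    unfolding l_def
  proof (rule GreatestI_ex_nat)
    show "\<exists>j. sat x j" using weq[OF that] by (simp add: sat_def)
    show "\<And>j. sat x j \<Longrightarrow> j \<le> J" by (simp add: sat_def)
  qed
  have l_max: "j \<le> l x" if "sat x j" for x j
    unfolding l_def using that by (rule Greatest_le_nat[where b = J]) (simp add: sat_def)
  have nested': "q k x = q k y" if "q j x = q j y" "j \<le> k" for j k x y
    using that(2) by (induction rule: dec_induct) (auto intro: nested that)
  define Q where "Q x = {y \<in> P. q (l x) y = q (l x) x}" for x
  have sat_cong: "sat x j \<longleftrightarrow> sat y j" if "q j x = q j y" for x y j
    using that by (simp add: sat_def)
  have Q_eq: "Q x = Q y" if "x \<in> P" "y \<in> P" "l x \<le> l y" "z \<in> Q x" "z \<in> Q y" for x y z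
  proof -
    have "q (l y) x = q (l y) y" using that nested'[of "l x" z x "l y"] by (auto simp: Q_def)
    hence "sat x (l y)" using sat_l[OF \<open>y \<in> P\<close>] sat_cong by blast
    hence "l x = l y" using l_max that(3) by fastforce
    thus ?thesis using \<open>q (l y) x = q (l y) y\<close> by (auto simp: Q_def)
  qed
  have Q_disj: "Q x = Q y" if "x \<in> P" "y \<in> P" "z \<in> Q x" "z \<in> Q y" for x y z
    using Q_eq[of x y z] Q_eq[of y x z] that by (cases "l x \<le> l y") auto
  \<comment> \<open>One representative per cell, so that no cell is counted twice in the
    sum.\<close>
  obtain R where R: "R \<subseteq> P" "inj_on Q R" "Q ` P = Q ` R"
    using subset_image_inj[of "Q ` P" Q P] by auto
  have memQ: "x \<in> Q x" if "x \<in> P" for x using that by (simp add: Q_def)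
  have cov: "(\<Union>x\<in>R. Q x) = P"
  proof
    show "P \<subseteq> (\<Union>x\<in>R. Q x)" using memQ R(3) by blast
  qed (auto simp: Q_def)
  have "(\<Sum>p\<in>P. w p) = (\<Sum>x\<in>R. \<Sum>p\<in>Q x. w p)"
    unfolding cov[symmetric]
  proof (rule sum.UNION_disjoint)
    show "finite R" using R(1) assms(1) finite_subset by blast
    show "\<forall>x\<in>R. finite (Q x)" using assms(1) by (simp add: Q_def)
    show "\<forall>x\<in>R. \<forall>y\<in>R. x \<noteq> y \<longrightarrow> Q x \<inter> Q y = {}"
      using R(1,2) Q_disj by (auto simp: inj_on_def) blast
  qed
  also have "\<dots> = (\<Sum>x\<in>R. m (l x))"
  proof (rule sum.cong[OF refl])
    fix x assume "x \<in> R"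
    thus "(\<Sum>p\<in>Q x. w p) = m (l x)" using sat_l[of x] R(1) by (auto simp: sat_def Q_def)
  qed
  finally have tot: "(\<Sum>x\<in>R. m (l x)) = (\<Sum>p\<in>P. w p)" by simp
  show thesis
  proof (rule that[of w R l])
    show "l x \<le> J" if "x \<in> R" for x using that sat_l R(1) by (auto simp: sat_def)
    show "\<exists>x\<in>R. q (l x) p = q (l x) x" if "p \<in> P" for p
      using that cov by (auto simp: Q_def)
  qed (use w0 wle R(1) tot in auto)
qed

subsection \<open>The kernel\<close>

lemma le_powr_if_le_one:
  fixes r \<theta> :: real
  assumes "0 < r" "r \<le> 1" "\<theta> \<le> 1"
  shows "r \<le> r powr \<theta>"
  using powr_mono'[of \<theta> 1 r] assms by simp

lemma phi_kernel_nonneg: "0 < r \<Longrightarrow> 0 \<le> phi_kernel r \<theta> s k x"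
  by (simp add: phi_kernel_def)

lemma phi_kernel_measurable [measurable]:
  "phi_kernel r \<theta> s k \<in> borel_measurable borel"
  unfolding phi_kernel_def[abs_def] by measurable

text \<open>Beyond \<open>r powr \<theta>\<close> the tail equals this power times
  \<open>(r powr \<theta> / norm x) powr (real k - s)\<close>, a factor at most 1. Together with the
  next bound, where the same factor is at least 1, the kernel outside the ball of radius
  \<open>r\<close> is at most the smaller of both formulas.\<close>

lemma phi_kernel_le_powr:
  assumes "0 < r" "r \<le> norm x" "s \<le> real k"
  shows "phi_kernel r \<theta> s k x \<le> (r / norm x) powr s"
proof (cases "norm x < r powr \<theta>")
  case True
  thus ?thesis using assms by (simp add: phi_kernel_def)
next
  case False
  define n where "n = norm x"
  have n: "n > 0" "r powr \<theta> \<le> n" using assms False by (auto simp: n_def)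
  have "r powr (\<theta> * (real k - s) + s) = (r powr \<theta>) powr (real k - s) * r powr s"
    by (simp add: powr_powr powr_add)
  also have "\<dots> \<le> n powr (real k - s) * r powr s"
    using n assms by (intro mult_right_mono powr_mono2) auto
  finally have "r powr (\<theta> * (real k - s) + s) / n ^ k \<le> n powr (real k - s) * r powr s / n ^ k"
    using n by (intro divide_right_mono) auto
  also have "\<dots> = (r / n) powr s"
    using n assms by (simp add: powr_diff powr_divide powr_realpow)
  finally show ?thesis using assms False by (simp add: phi_kernel_def n_def)
qed

lemma phi_kernel_le_tail:
  assumes "0 < r" "r \<le> norm x" "s \<le> real k"
  shows "phi_kernel r \<theta> s k x \<le> r powr (\<theta> * (real k - s) + s) / norm x ^ k"
proof (cases "norm x < r powr \<theta>")
  case False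
  thus ?thesis using assms by (simp add: phi_kernel_def)
next
  case True
  define n where "n = norm x"
  have n: "n > 0" "n \<le> r powr \<theta>" using assms True by (auto simp: n_def)
  have "r powr (\<theta> * (real k - s) + s) = (r powr \<theta>) powr (real k - s) * r powr s"
    by (simp add: powr_powr powr_add)
  also have "\<dots> \<ge> n powr (real k - s) * r powr s"
    using n assms by (intro mult_right_mono powr_mono2) auto
  finally have "r powr (\<theta> * (real k - s) + s) / n ^ k \<ge> n powr (real k - s) * r powr s / n ^ k"
    using n by (intro divide_right_mono) auto
  also have "n powr (real k - s) * r powr s / n ^ k = (r / n) powr s"
    using n assms by (simp add: powr_diff powr_divide powr_realpow)
  finally show ?thesis using assms True by (simp add: phi_kernel_def n_def)
qed

lemma phi_kernel_le_one:
  assumes "0 < r" "0 \<le> s" "s \<le> real k"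
  shows "phi_kernel r \<theta> s k x \<le> 1"
proof (cases "norm x < r")
  case False
  hence "phi_kernel r \<theta> s k x \<le> (r / norm x) powr s"
    using assms by (intro phi_kernel_le_powr) auto
  also have "\<dots> \<le> 1 powr s" using False assms by (intro powr_mono2) (auto simp: divide_le_eq)
  finally show ?thesis by simp
qed (simp add: phi_kernel_def)

text \<open>The kernel decreases with the distance, and \<open>(r / D) powr s\<close> is its value
  at distance \<open>D\<close>.\<close>

lemma phi_kernel_ge_powr:
  assumes "0 < r" "norm x \<le> D" "r \<le> D" "D \<le> r powr \<theta>" "0 \<le> s"
  shows "(r / D) powr s \<le> phi_kernel r \<theta> s k x"
proof -
  have D: "D > 0" using assms by linarith
  \<comment> \<open>At distance exactly \<open>r powr \<theta>\<close> the tail formula already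
    applies; it agrees there with the middle one.\<close>
  consider "norm x < r" | "r \<le> norm x" "norm x < r powr \<theta>" | "\<not> norm x < r" "norm x = r powr \<theta>" "D = r powr \<theta>"
    using assms by linarith
  thus ?thesis
  proof cases
    case 1
    have "(r / D) powr s \<le> 1 powr s" using assms D by (intro powr_mono2) auto
    thus ?thesis using 1 by (simp add: phi_kernel_def)
  next
    case 2
    hence "(r / D) powr s \<le> (r / norm x) powr s"
      using assms D by (intro powr_mono2 divide_left_mono mult_pos_pos) (auto simp del: zero_less_norm_iff)
    thus ?thesis using 2 by (simp add: phi_kernel_def)
  next
    case 3
    have "(r powr \<theta>) ^ k = r powr (\<theta> * k)"
      using assms by (simp add: powr_realpow[symmetric] powr_powr)
    hence "r powr (\<theta> * (real k - s) + s) / (r powr \<theta>) ^ k = r powr (s - \<theta> * s)"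
      using assms(1) by (simp add: powr_diff[symmetric] algebra_simps)
    also have "\<dots> = (r / D) powr s"
      using assms(1) 3 by (simp add: powr_divide powr_powr powr_diff)
    finally show ?thesis using 3 by (simp add: phi_kernel_def)
  qed
qed

text \<open>In the middle range the base is at most 1; in the tail the exponent
  \<open>\<theta> * real k + (1 - \<theta>) * s\<close> of \<open>r\<close> is nondecreasing in
  \<open>s\<close>.\<close>

lemma phi_kernel_antimono:
  assumes "0 < r" "r \<le> 1" "\<theta> \<le> 1" "0 \<le> t" "t \<le> s"
  shows "phi_kernel r \<theta> s k x \<le> phi_kernel r \<theta> t k x"
proof -
  have "(r / norm x) powr s \<le> (r / norm x) powr t" if "r \<le> norm x"
    using that assms by (intro powr_mono') (auto simp: divide_le_eq)
  moreover have "r powr (\<theta> * (real k - s) + s) / norm x ^ k \<le> r powr (\<theta> * (real k - t) + t) / norm x ^ k"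
  proof (intro divide_right_mono powr_mono')
    have "0 \<le> (1 - \<theta>) * (s - t)" using assms by simp
    thus "\<theta> * (real k - t) + t \<le> \<theta> * (real k - s) + s" by (simp add: algebra_simps)
  qed (use assms in auto)
  ultimately show ?thesis by (auto simp: phi_kernel_def)
qed

text \<open>In the tail the two kernels differ by exactly this factor; in the middle range their
  quotient is \<open>(norm x / r) powr (s - t)\<close> with \<open>norm x < r powr \<theta>\<close>.
  The exponent later yields the Lipschitz constant \<open>1 - \<theta>\<close>.\<close>

lemma phi_kernel_le_mult:
  assumes "0 < r" "r \<le> 1" "\<theta> \<le> 1" "t \<le> s"
  shows "phi_kernel r \<theta> t k x \<le> r powr - ((1 - \<theta>) * (s - t)) * phi_kernel r \<theta> s k x"
proof -
  consider "norm x < r" | "r \<le> norm x" "norm x < r powr \<theta>" | "\<not> norm x < r" "\<not> norm x < r powr \<theta>"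
    by linarith
  thus ?thesis
  proof cases
    case 1
    have "(1 - \<theta>) * (s - t) \<ge> 0" using assms by simp
    hence "1 \<le> r powr - ((1 - \<theta>) * (s - t))"
      using powr_mono'[of "- ((1 - \<theta>) * (s - t))" 0 r] assms by simp
    thus ?thesis using 1 by (simp add: phi_kernel_def)
  next
    case 2
    have n: "norm x > 0" using 2 assms by linarith
    have "(r / norm x) powr t = (norm x / r) powr (s - t) * (r / norm x) powr s"
      using n assms by (simp add: powr_divide powr_diff)
    also have "(norm x / r) powr (s - t) \<le> (r powr \<theta> / r) powr (s - t)"
      using 2 n assms by (intro powr_mono2 divide_right_mono) auto
    also have "(r powr \<theta> / r) powr (s - t) = r powr - ((1 - \<theta>) * (s - t))"
      using assms powr_diff[of r \<theta> 1, symmetric] by (simp add: powr_powr) (simp add: algebra_simps)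
    finally show ?thesis using 2 by (simp add: phi_kernel_def mult_right_mono)
  next
    case 3
    have "r powr (\<theta> * (real k - t) + t)
        = r powr - ((1 - \<theta>) * (s - t)) * r powr (\<theta> * (real k - s) + s)"
      using assms by (simp add: powr_add[symmetric]) (simp add: algebra_simps)
    thus ?thesis using 3 by (simp add: phi_kernel_def)
  qed
qed

lemma supp_prob_measuresD:
  assumes "\<mu> \<in> supp_prob_measures X"
  shows "prob_space \<mu>" "sets \<mu> = sets borel" "space \<mu> = UNIV" "AE x in \<mu>. x \<in> closure X"
proof -
  show p: "prob_space \<mu>" and s: "sets \<mu> = sets borel"
    using assms by (auto simp: supp_prob_measures_def)
  show sp: "space \<mu> = UNIV" using sets_eq_imp_space_eq[OF s] by simp
  show "AE x in \<mu>. x \<in> closure X"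
    using assms s sp by (intro AE_I[of _ _ "- closure X"]) (auto simp: supp_prob_measures_def)
qed

lemma potential_measurable:
  fixes \<mu> :: "'a::euclidean_space measure"
  assumes "sigma_finite_measure \<mu>" "sets \<mu> = sets borel"
  shows "(\<lambda>x. \<integral>\<^sup>+ y. ennreal (phi_kernel r \<theta> s k (x - y)) \<partial>\<mu>) \<in> borel_measurable borel"
proof -
  interpret sigma_finite_measure \<mu> by fact
  have [measurable_cong]: "sets \<mu> = sets borel" by fact
  show ?thesis by measurable
qed

subsection \<open>Energy and covers\<close>

text \<open>Cauchy--Schwarz for the overlapping sets of a cover, in the linearised form
  \<open>a + l\<^sup>2 / a \<ge> 2 * l\<close>: the potential \<open>a\<close> is at least \<open>1 / b\<close>, and \<open>b\<close> is easy to integrate.\<close>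

lemma energy_ge_if_cover:
  fixes X :: "'a::euclidean_space set"
  assumes \<mu>: "\<mu> \<in> supp_prob_measures X" and r: "0 < r" and s: "0 \<le> s"
    and U: "finite U" "X \<subseteq> \<Union>U"
    and diam: "\<And>u. u \<in> U \<Longrightarrow> bounded u" "\<And>u. u \<in> U \<Longrightarrow> r \<le> diameter u"
      "\<And>u. u \<in> U \<Longrightarrow> diameter u \<le> r powr \<theta>"
  shows "ennreal (r powr s / (\<Sum>u\<in>U. diameter u powr s)) \<le> energy r \<theta> s k \<mu>"
proof -
  note m = supp_prob_measuresD[OF \<mu>]
  interpret prob_space \<mu> by fact
  define a where "a x = (\<integral>\<^sup>+ y. ennreal (phi_kernel r \<theta> s k (x - y)) \<partial>\<mu>)" for x
  have [measurable_cong]: "sets \<mu> = sets borel" by fact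
  have a_meas [measurable]: "a \<in> borel_measurable borel"
    unfolding a_def[abs_def] using m(2) by (intro potential_measurable) unfold_locales
  \<comment> \<open>Sets with null closure are dropped, since \<open>b\<close> below divides by
    these probabilities. Closures are measurable and keep the diameter.\<close>
  define V where "V = {u \<in> U. prob (closure u) > 0}"
  have finV: "finite V" using U(1) by (simp add: V_def)
  have AEV: "AE x in \<mu>. \<exists>u\<in>V. x \<in> closure u"
  proof -
    have "AE x in \<mu>. \<forall>u\<in>U-V. x \<notin> closure u"
    proof (intro AE_finite_allI)
      show "AE x in \<mu>. x \<notin> closure u" if "u \<in> U - V" for u
        using that measure_nonneg[of \<mu> "closure u"]
        by (intro AE_I[of _ _ "closure u"]) (auto simp: V_def emeasure_eq_measure)
    qed (use U(1) in auto)
    with m(4) show ?thesis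
    proof eventually_elim
      case (elim x)
      \<comment> \<open>\<open>U\<close> is finite, so the union of the closures is closed and
        contains \<open>closure X\<close>, where the measure lives.\<close>
      have "closure X \<subseteq> (\<Union>u\<in>U. closure u)"
        using U by (intro closure_minimal closed_UN) (auto intro: closure_subset[THEN subsetD])
      with elim show ?case by blast
    qed
  qed
  \<comment> \<open>For \<open>u\<close> in \<open>U\<close>, the reciprocal of \<open>g u\<close>
    bounds the kernel from below between any two points of \<open>closure u\<close>.\<close>
  define g where "g u = (diameter u / r) powr s" for u :: "'a set"
  define b where "b x = (\<Sum>u\<in>V. g u / prob (closure u) * indicator (closure u) x)" for x
  have [measurable]: "closure u \<in> sets borel" for u :: "'a set" by simp
  have b_meas [measurable]: "b \<in> borel_measurable borel"
    unfolding b_def[abs_def] by measurable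
  have g0: "g u > 0" if "u \<in> U" for u using diam(2)[OF that] r by (simp add: g_def)
  have b0: "b x \<ge> 0" for x
    unfolding b_def by (intro sum_nonneg) (auto simp: g_def)
  define T where "T = (\<Sum>u\<in>U. g u)"
  have "U \<noteq> {}" using AEV by (auto simp: V_def)
  hence T0: "T > 0" unfolding T_def using U(1) g0 by (intro sum_pos) auto
  \<comment> \<open>With this value \<open>l\<^sup>2 * T = l\<close>, so half of
    \<open>2 * l\<close> survives when the integral of \<open>l\<^sup>2 * b\<close> is taken
    away.\<close>
  define l where "l = 1 / T"
  have l0: "l > 0" using T0 by (simp add: l_def)
  have ab: "AE x in \<mu>. ennreal (2 * l) \<le> a x + ennreal (l\<^sup>2 * b x)"
    using AEV
  proof eventually_elim
    case (elim x)
    then obtain u where u: "u \<in> V" "x \<in> closure u" by blast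
    define p where "p = prob (closure u)"
    have p0: "p > 0" and uU: "u \<in> U" using u by (auto simp: V_def p_def)
    have "ennreal (p / g u) = (\<integral>\<^sup>+ y. ennreal (1 / g u) * indicator (closure u) y \<partial>\<mu>)"
      using g0[OF uU] by (simp add: nn_integral_cmult_indicator p_def emeasure_eq_measure
          ennreal_mult[symmetric])
    also have "\<dots> \<le> a x"
      unfolding a_def
    proof (intro nn_integral_mono)
      fix y
      show "ennreal (1 / g u) * indicator (closure u) y \<le> ennreal (phi_kernel r \<theta> s k (x - y))"
      proof (cases "y \<in> closure u")
        case True
        have "dist x y \<le> diameter (closure u)"
          using diam(1)[OF uU] u(2) True by (intro diameter_bounded_bound) auto
        hence "norm (x - y) \<le> diameter u"
          using diam(1)[OF uU] by (simp add: diameter_closure dist_norm)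
        hence "(r / diameter u) powr s \<le> phi_kernel r \<theta> s k (x - y)"
          using diam(2,3)[OF uU] r s by (intro phi_kernel_ge_powr) auto
        moreover have "1 / g u = (r / diameter u) powr s"
          using r diam(2)[OF uU] by (simp add: g_def powr_divide)
        ultimately show ?thesis using True by (simp add: ennreal_leI)
      qed simp
    qed
    finally have ax: "ennreal (p / g u) \<le> a x" .
    have "g u / p * indicator (closure u) x \<le> b x"
      unfolding b_def p_def using u(1) finV
      by (intro member_le_sum) (auto simp: g_def)
    hence bx: "g u / p \<le> b x" using u(2) by simp
    define c where "c = p / g u"
    have c0: "c > 0" using p0 g0[OF uU] by (simp add: c_def)
    have "2 * l \<le> c + l\<^sup>2 * (1 / c)"
    proof -
      have "0 \<le> (c - l)\<^sup>2 / c" using c0 by simp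
      also have "\<dots> = c + l\<^sup>2 * (1 / c) - 2 * l"
        using c0 by (simp add: power2_eq_square field_simps)
      finally show ?thesis by simp
    qed
    also have "\<dots> \<le> c + l\<^sup>2 * b x"
      using bx by (intro add_left_mono mult_left_mono) (auto simp: c_def)
    finally have "ennreal (2 * l) \<le> ennreal c + ennreal (l\<^sup>2 * b x)"
      using c0 b0[of x] by (simp add: ennreal_plus[symmetric] ennreal_leI del: ennreal_plus)
    also have "\<dots> \<le> a x + ennreal (l\<^sup>2 * b x)" using ax by (intro add_right_mono) (simp add: c_def)
    finally show ?case .
  qed
  have "ennreal (2 * l) = (\<integral>\<^sup>+ x. ennreal (2 * l) \<partial>\<mu>)" by (simp add: emeasure_space_1)
  also have "\<dots> \<le> (\<integral>\<^sup>+ x. a x + ennreal (l\<^sup>2 * b x) \<partial>\<mu>)"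
    by (rule nn_integral_mono_AE[OF ab])
  also have "\<dots> = energy r \<theta> s k \<mu> + (\<integral>\<^sup>+ x. ennreal (l\<^sup>2 * b x) \<partial>\<mu>)"
    unfolding energy_def a_def[symmetric] by (rule nn_integral_add) measurable
  also have "(\<integral>\<^sup>+ x. ennreal (l\<^sup>2 * b x) \<partial>\<mu>) = ennreal (l\<^sup>2 * (\<Sum>u\<in>V. g u))"
  proof -
    have ind: "integrable \<mu> (indicat_real (closure u))" for u :: "'a set"
      by (intro integrable_real_indicator) (auto simp: emeasure_eq_measure)
    have "(\<integral>x. l\<^sup>2 * b x \<partial>\<mu>) = l\<^sup>2 * (\<Sum>u\<in>V. g u / prob (closure u) * prob (closure u))"
      unfolding b_def using ind by (simp add: Bochner_Integration.integral_sum m(3))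
    also have "\<dots> = l\<^sup>2 * (\<Sum>u\<in>V. g u)"
      by (intro arg_cong2[where f = "(*)"] refl sum.cong) (auto simp: V_def)
    finally have "(\<integral>x. l\<^sup>2 * b x \<partial>\<mu>) = l\<^sup>2 * (\<Sum>u\<in>V. g u)" .
    moreover have "integrable \<mu> (\<lambda>x. l\<^sup>2 * b x)"
      unfolding b_def by (intro integrable_mult_right Bochner_Integration.integrable_sum ind)
    ultimately show ?thesis by (subst nn_integral_eq_integral) (auto simp: b0)
  qed
  also have "\<dots> \<le> ennreal (l\<^sup>2 * T)"
    unfolding T_def using U(1) g0
    by (intro ennreal_leI mult_left_mono sum_mono2) (auto simp: V_def less_imp_le)
  also have "l\<^sup>2 * T = l" using T0 by (simp add: l_def power2_eq_square)
  finally have "ennreal (2 * l) \<le> energy r \<theta> s k \<mu> + ennreal l" by (simp add: add_left_mono)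
  moreover have "ennreal (2 * l) = ennreal l + ennreal l" using l0 by (simp add: ennreal_plus[symmetric] del: ennreal_plus)
  ultimately have "ennreal l \<le> energy r \<theta> s k \<mu>"
    by (simp add: add.commute[of "energy r \<theta> s k \<mu>"])
  moreover have "T = (\<Sum>u\<in>U. diameter u powr s) / r powr s"
    unfolding T_def g_def sum_divide_distrib using r diam(2)
    by (intro sum.cong) (auto simp: powr_divide)
  ultimately show ?thesis by (simp add: l_def)
qed

section \<open>Grid nets and covers by balls of one size\<close>

lemma finite_grid_net:
  fixes X :: "'a::euclidean_space set"
  assumes "h > 0" and "\<And>x. x \<in> X \<Longrightarrow> norm x \<le> real L * h"
  obtains P where "finite P" "P \<subseteq> X" "inj_on (grid_cell h) P"
    "grid_cell h ` P = grid_cell h ` X" "card P \<le> (2 * L + 1) ^ DIM('a)"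
proof -
  note cells = card_grid_cells_le[of h X 0 L, OF assms(1)]
  obtain P where P: "P \<subseteq> X" "inj_on (grid_cell h) P" "grid_cell h ` X = grid_cell h ` P"
    using subset_image_inj[of "grid_cell h ` X" "grid_cell h" X] by auto
  have "finite P" using cells(1) assms(2) P by (auto simp: finite_image_iff dist_norm)
  moreover have "card P \<le> (2 * L + 1) ^ DIM('a)"
    using cells(2) assms(2) P by (simp add: card_image[symmetric] dist_norm)
  ultimately show thesis using that P by simp
qed

text \<open>Balls of diameter \<open>r\<close> around a grid net of mesh
  \<open>r / (2 * DIM('a))\<close> contain the cells they represent. These covers give positivity of
  the infimal energy and the bounds at exponents from \<open>DIM('a)\<close> upwards.\<close>

lemma uniform_cover:
  fixes X :: "'a::euclidean_space set"
  assumes "bounded X"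
  obtains c where "c > 0" "\<And>r. 0 < r \<Longrightarrow> r \<le> 1 \<Longrightarrow>
    \<exists>U. finite U \<and> X \<subseteq> \<Union>U \<and> (\<forall>u\<in>U. bounded u \<and> diameter u = r) \<and>
      real (card U) * r ^ DIM('a) \<le> c"
proof -
  obtain B where B: "B > 0" "\<And>x. x \<in> X \<Longrightarrow> norm x \<le> B"
    using assms bounded_pos by blast
  define D where "D = real DIM('a)"
  have D: "D \<ge> 1" unfolding D_def using DIM_positive[where 'a='a] by linarith
  show thesis
  \<comment> \<open>The number of balls is at most \<open>(2 * L + 1) ^ DIM('a)\<close> with
    \<open>L \<le> 2 * D * B / r + 1\<close>; multiplying the base by \<open>r \<le> 1\<close> gives
    at most \<open>4 * D * B + 3\<close>.\<close>
  proof (rule that[of "(4 * D * B + 3) ^ DIM('a)"])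
    show "(4 * D * B + 3) ^ DIM('a) > 0" using B D by (intro zero_less_power add_nonneg_pos) auto
    fix r :: real assume r: "0 < r" "r \<le> 1"
    define h where "h = r / (2 * D)"
    have h: "h > 0" using r D by (simp add: h_def)
    define L where "L = nat \<lceil>B / h\<rceil>"
    have "real L = of_int \<lceil>B / h\<rceil>" using B h by (simp add: L_def)
    have L: "B / h \<le> real L" "real L \<le> B / h + 1"
      using \<open>real L = of_int \<lceil>B / h\<rceil>\<close> by linarith+
    have "norm x \<le> real L * h" if "x \<in> X" for x
      using B(2)[OF that] L(1) h by (simp add: field_simps)
    then obtain P where P: "finite P" "P \<subseteq> X" "grid_cell h ` P = grid_cell h ` X"
      "card P \<le> (2 * L + 1) ^ DIM('a)"
      using finite_grid_net[OF h, of X L] by metis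
    let ?U = "(\<lambda>p. cball p (r / 2)) ` P"
    have "X \<subseteq> \<Union>?U"
    proof
      fix x assume "x \<in> X"
      then obtain p where p: "p \<in> P" "grid_cell h p = grid_cell h x" using P(3) by (metis imageE imageI)
      have "dist p x \<le> DIM('a) * h" by (rule dist_le_if_grid_cell_eq[OF h p(2)])
      also have "\<dots> = r / 2" using D by (simp add: h_def D_def)
      finally show "x \<in> \<Union>?U" using p(1) by auto
    qed
    moreover have "real (card ?U) * r ^ DIM('a) \<le> (4 * D * B + 3) ^ DIM('a)"
    proof -
      have "real (card ?U) \<le> real ((2 * L + 1) ^ DIM('a))"
        using card_image_le[OF P(1), of "\<lambda>p. cball p (r / 2)"] P(4) by linarith
      also have "\<dots> = (2 * real L + 1) ^ DIM('a)" by (simp add: add.commute)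
      finally have "real (card ?U) * r ^ DIM('a) \<le> (2 * real L + 1) ^ DIM('a) * r ^ DIM('a)"
        using r by (intro mult_right_mono) auto
      also have "\<dots> = ((2 * real L + 1) * r) ^ DIM('a)" by (simp add: power_mult_distrib)
      also have "\<dots> \<le> (4 * D * B + 3) ^ DIM('a)"
      proof (rule power_mono)
        have "(2 * real L + 1) * r \<le> (2 * (B / h + 1) + 1) * r"
          using L(2) r by (intro mult_right_mono) auto
        also have "\<dots> = 4 * D * B + 3 * r" using r D by (simp add: h_def field_simps)
        finally show "(2 * real L + 1) * r \<le> 4 * D * B + 3" using r by linarith
      qed (use r in auto)
      finally show ?thesis .
    qed
    ultimately show "\<exists>U. finite U \<and> X \<subseteq> \<Union>U \<and> (\<forall>u\<in>U. bounded u \<and> diameter u = r) \<and>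
      real (card U) * r ^ DIM('a) \<le> (4 * D * B + 3) ^ DIM('a)"
      using P(1) r by (intro exI[of _ ?U]) auto
  qed
qed

section \<open>Potentials and energies of Frostman weights\<close>

text \<open>The bracket is, up to a constant, the mass bound for a ball of radius
  \<open>2 ^ i * r\<close>, which is covered by about \<open>2 ^ ((i - min i J) * k)\<close> cells
  of level \<open>min i J\<close>. The power bound on the kernel balances it for
  \<open>i \<le> J\<close>, the tail bound for larger \<open>i\<close>.\<close>

lemma phi_kernel_shell:
  fixes k :: nat and r s \<theta> :: real
  assumes r: "0 < r" and s: "0 \<le> s" "s \<le> real k" and J: "r powr \<theta> \<le> 2 ^ Suc J * r"
    and i: "i > 0" "2 ^ (i - 1) * r \<le> norm z"
  shows "phi_kernel r \<theta> s k z * (2 ^ ((i - min i J) * k) * (2 ^ min i J * r) powr s)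
    \<le> 4 ^ k * r powr s"
proof -
  define n where "n = norm z"
  have "(1::real) * r \<le> 2 ^ (i - 1) * r" using r by (intro mult_right_mono) auto
  hence n: "r \<le> n" "n > 0" using i r unfolding n_def by linarith+
  have i2: "2 ^ i * r \<le> 2 * n"
    using i by (cases i) (auto simp: n_def)
  show ?thesis
  proof (cases "i \<le> J")
    case True
    have "phi_kernel r \<theta> s k z * (2 ^ i * r) powr s \<le> (r / n) powr s * (2 ^ i * r) powr s"
      using phi_kernel_le_powr[of r z s k \<theta>] r n s by (intro mult_right_mono) (auto simp: n_def)
    also have "\<dots> = (r * (2 ^ i * r / n)) powr s"
      using r n by (subst powr_mult[symmetric]) (auto simp: field_simps)
    also have "\<dots> \<le> (r * 2) powr s"
      using i2 r n s by (intro powr_mono2 mult_left_mono) (auto simp: divide_le_eq)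
    also have "\<dots> = 2 powr s * r powr s" using r by (simp add: powr_mult)
    also have "2 powr s \<le> 4 powr s" using s by (intro powr_mono2) auto
    also have "4 powr s \<le> 4 powr real k" using s by (intro powr_mono) auto
    finally show ?thesis using True by (simp add: powr_realpow mult_right_mono)
  next
    case False
    define a where "a = 2 ^ J * r"
    define q where "q = (2::real) ^ (i - J)"
    have a: "a > 0" "r powr \<theta> \<le> 2 * a" using r J by (auto simp: a_def)
    have q: "q > 0" "q * a \<le> 2 * n"
      using i2 False by (auto simp: q_def a_def mult.assoc[symmetric] power_add[symmetric])
    have "phi_kernel r \<theta> s k z \<le> r powr (\<theta> * (real k - s) + s) / n ^ k"
      using phi_kernel_le_tail[of r z s k \<theta>] r n s by (simp add: n_def)
    also have "r powr (\<theta> * (real k - s) + s) = (r powr \<theta>) powr (real k - s) * r powr s"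
      by (simp add: powr_powr powr_add)
    also have "\<dots> / n ^ k \<le> (2 * a) powr (real k - s) * r powr s / n ^ k"
      using a s n by (intro divide_right_mono mult_right_mono powr_mono2) auto
    \<comment> \<open>Enlarging \<open>a powr s\<close> to \<open>(2 * a) powr s\<close> lets the
      exponents \<open>real k - s\<close> and \<open>s\<close> add up to \<open>k\<close>.\<close>
    finally have "phi_kernel r \<theta> s k z * (q ^ k * a powr s)
        \<le> (2 * a) powr (real k - s) * r powr s / n ^ k * (q ^ k * (2 * a) powr s)"
      using a s n q by (intro mult_mono mult_left_mono powr_mono2) auto
    also have "\<dots> = (2 * a) powr (real k - s + s) * (q / n) ^ k * r powr s"
      using n by (subst powr_add) (simp add: power_divide)
    also have "\<dots> = (2 * a * (q / n)) ^ k * r powr s"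
      using a powr_realpow[of "2 * a" k] by (simp add: power_mult_distrib power_divide)
    also have "\<dots> \<le> 4 ^ k * r powr s"
    proof (intro mult_right_mono power_mono)
      show "2 * a * (q / n) \<le> 4" using q n by (simp add: field_simps)
    qed (use a q n in auto)
    finally show ?thesis using False by (simp add: a_def q_def power_mult)
  qed
qed

text \<open>The cells of level \<open>j\<close> that meet the ball are counted, and each has mass at
  most \<open>m\<close>; the part of a cell outside the ball only adds nonnegative weight.\<close>

lemma ball_mass_le:
  fixes P :: "'a::euclidean_space set" and w :: "'a \<Rightarrow> real" and r m :: real
  assumes P: "finite P" and w: "\<And>y. y \<in> P \<Longrightarrow> 0 \<le> w y" and r: "r > 0"
    and ji: "j \<le> i"
    and cell: "\<And>x. x \<in> P \<Longrightarrow>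
      (\<Sum>y | y \<in> P \<and> grid_cell (2 ^ j * (r / (2 * DIM('a)))) y
                    = grid_cell (2 ^ j * (r / (2 * DIM('a)))) x. w y) \<le> m"
    and m: "m \<ge> 0"
  shows "(\<Sum>y | y \<in> P \<and> dist x y \<le> 2 ^ i * r. w y)
    \<le> (5 * DIM('a)) ^ DIM('a) * (2 ^ ((i - j) * DIM('a)) * m)"
proof -
  let ?d = "DIM('a)"
  define h where "h = 2 ^ j * (r / (2 * real ?d))"
  have h: "h > 0" using r by (simp add: h_def)
  define S where "S = {y \<in> P. dist x y \<le> 2 ^ i * r}"
  \<comment> \<open>The radius \<open>2 ^ i * r\<close> in units of the mesh \<open>h\<close>; then
    \<open>2 * L + 1\<close> is at most \<open>5 * ?d * 2 ^ (i - j)\<close>.\<close>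
  define L where "L = 2 * ?d * 2 ^ (i - j)"
  have "real L * h = 2 ^ (i - j) * 2 ^ j * r" by (simp add: L_def h_def)
  also have "\<dots> = 2 ^ i * r" using ji by (simp add: power_add[symmetric])
  finally have Lh: "real L * h = 2 ^ i * r" .
  have crd: "card (grid_cell h ` S) \<le> (2 * L + 1) ^ ?d"
    using h Lh by (intro card_grid_cells_le(2)[of h S x]) (auto simp: S_def)
  have "(\<Sum>y\<in>S. w y) = (\<Sum>c\<in>grid_cell h ` S. \<Sum>y | y \<in> S \<and> grid_cell h y = c. w y)"
    using P by (intro sum.image_gen) (simp add: S_def)
  also have "\<dots> \<le> (\<Sum>c\<in>grid_cell h ` S. m)"
  proof (intro sum_mono)
    fix c assume "c \<in> grid_cell h ` S"
    then obtain z where z: "z \<in> P" "c = grid_cell h z" by (auto simp: S_def)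
    have "(\<Sum>y | y \<in> S \<and> grid_cell h y = c. w y) \<le> (\<Sum>y | y \<in> P \<and> grid_cell h y = grid_cell h z. w y)"
      using P w z by (intro sum_mono2) (auto simp: S_def)
    also have "\<dots> \<le> m" using cell[OF z(1)] by (simp add: h_def)
    finally show "(\<Sum>y | y \<in> S \<and> grid_cell h y = c. w y) \<le> m" .
  qed
  also have "\<dots> = real (card (grid_cell h ` S)) * m" by simp
  also have "\<dots> \<le> real ((5 * ?d * 2 ^ (i - j)) ^ ?d) * m"
  proof (intro mult_right_mono of_nat_mono)
    have "1 \<le> ?d * 2 ^ (i - j)" by (simp add: Suc_le_eq)
    hence "2 * L + 1 \<le> 5 * ?d * 2 ^ (i - j)" unfolding L_def by linarith
    hence "(2 * L + 1) ^ ?d \<le> (5 * ?d * 2 ^ (i - j)) ^ ?d" by (intro power_mono) auto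
    thus "card (grid_cell h ` S) \<le> (5 * ?d * 2 ^ (i - j)) ^ ?d" using crd by linarith
  qed (use m in auto)
  finally show ?thesis by (simp add: S_def power_mult_distrib power_mult)
qed

text \<open>Points are sorted into dyadic shells around \<open>x\<close>. The decay of the kernel
  offsets the growth of the mass, so all shells obey the same bound and only their number is lost.
  The factor 20 is 4 from the kernel times 5 from the cell count.\<close>

lemma potential_le_if_frostman:
  fixes P :: "'a::euclidean_space set" and w :: "'a \<Rightarrow> real" and r s \<theta> :: real
  assumes P: "finite P" and w: "\<And>y. y \<in> P \<Longrightarrow> 0 \<le> w y" and r: "0 < r"
    and s: "0 \<le> s" "s \<le> DIM('a)" and J: "r powr \<theta> \<le> 2 ^ Suc J * r"
    and cell: "\<And>j x. j \<le> J \<Longrightarrow> x \<in> P \<Longrightarrow>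
      (\<Sum>y | y \<in> P \<and> grid_cell (2 ^ j * (r / (2 * DIM('a)))) y
                    = grid_cell (2 ^ j * (r / (2 * DIM('a)))) x. w y) \<le> (2 ^ j * r) powr s"
    and N: "\<And>y. y \<in> P \<Longrightarrow> dist x y < 2 ^ N * r"
  shows "(\<Sum>y\<in>P. phi_kernel r \<theta> s DIM('a) (x - y) * w y)
    \<le> real (Suc N) * ((20 * DIM('a)) ^ DIM('a) * r powr s)"
proof -
  let ?d = "DIM('a)"
  let ?\<phi> = "\<lambda>y. phi_kernel r \<theta> s ?d (x - y)"
  define sh where "sh y = (LEAST i. dist x y < 2 ^ i * r)" for y
  have sh: "dist x y < 2 ^ sh y * r" "sh y \<le> N" if "y \<in> P" for y
    unfolding sh_def using N[OF that] by (auto intro: LeastI Least_le)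
  have shlow: "2 ^ (sh y - 1) * r \<le> dist x y" if "sh y > 0" for y
    using not_less_Least[of "sh y - 1" "\<lambda>i. dist x y < 2 ^ i * r"] that
    unfolding sh_def[symmetric] by simp
  have shell: "(\<Sum>y | y \<in> P \<and> sh y = i. ?\<phi> y * w y) \<le> (20 * ?d) ^ ?d * r powr s" for i
  proof -
    define b where "b = 2 ^ ((i - min i J) * ?d) * (2 ^ min i J * r) powr s"
    have b: "b > 0" using r by (simp add: b_def)
    have \<phi>le: "?\<phi> y \<le> 4 ^ ?d * r powr s / b" if "sh y = i" for y
    \<comment> \<open>Shell 0 has no lower bound on the distance; there \<open>b = r powr s\<close>,
      and the trivial kernel bound 1 suffices.\<close>
    proof (cases "i = 0")
      case True
      have "?\<phi> y \<le> 1" using r s by (intro phi_kernel_le_one) auto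
      also have "1 \<le> (4::real) ^ ?d" by simp
      also have "(4::real) ^ ?d = 4 ^ ?d * r powr s / b" using True r by (simp add: b_def)
      finally show ?thesis .
    next
      case False
      thus ?thesis
        using phi_kernel_shell[of r s ?d \<theta> J i "x - y"] shlow[of y] that r s J b
        by (simp add: b_def[symmetric] dist_norm pos_le_divide_eq)
    qed
    have "(\<Sum>y | y \<in> P \<and> sh y = i. ?\<phi> y * w y)
        \<le> (\<Sum>y | y \<in> P \<and> sh y = i. 4 ^ ?d * r powr s / b * w y)"
      using w \<phi>le by (intro sum_mono mult_right_mono) auto
    also have "\<dots> \<le> (\<Sum>y | y \<in> P \<and> dist x y \<le> 2 ^ i * r. 4 ^ ?d * r powr s / b * w y)"
      using P w b sh(1) by (intro sum_mono2) (auto intro: less_imp_le)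
    also have "\<dots> = 4 ^ ?d * r powr s / b * (\<Sum>y | y \<in> P \<and> dist x y \<le> 2 ^ i * r. w y)"
      by (simp add: sum_distrib_left)
    also have "\<dots> \<le> 4 ^ ?d * r powr s / b * ((5 * ?d) ^ ?d * b)"
    proof (rule mult_left_mono)
      show "(\<Sum>y | y \<in> P \<and> dist x y \<le> 2 ^ i * r. w y) \<le> (5 * ?d) ^ ?d * b"
        unfolding b_def using P w r by (rule ball_mass_le) (use cell in auto)
    qed (use b in auto)
    also have "\<dots> = (20 * ?d) ^ ?d * r powr s" 
    proof -
      have "(20::real) ^ ?d = 4 ^ ?d * 5 ^ ?d" by (subst power_mult_distrib[symmetric]) simp
      thus ?thesis using b by (simp add: power_mult_distrib)
    qed
    finally show ?thesis .
  qed
  have "(\<Sum>y\<in>P. ?\<phi> y * w y) = (\<Sum>i\<in>{..N}. \<Sum>y | y \<in> P \<and> sh y = i. ?\<phi> y * w y)"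
    using P sh(2) by (intro sum.group[symmetric]) auto
  also have "\<dots> \<le> (\<Sum>i\<in>{..N}. (20 * ?d) ^ ?d * r powr s)"
    by (intro sum_mono shell)
  finally show ?thesis by simp
qed

text \<open>The normalised weights form a probability measure whose energy is an average of
  potentials, each at most \<open>K / M\<close>.\<close>

lemma discrete_energy_le:
  fixes P :: "'a::euclidean_space set" and w :: "'a \<Rightarrow> real"
  assumes P: "finite P" "P \<subseteq> X" and w: "\<And>y. y \<in> P \<Longrightarrow> 0 \<le> w y"
    and M: "(\<Sum>y\<in>P. w y) = M" "M > 0" and r: "r > 0"
    and K: "\<And>x. x \<in> P \<Longrightarrow> (\<Sum>y\<in>P. phi_kernel r \<theta> s k (x - y) * w y) \<le> K"
  shows "\<exists>\<mu>\<in>supp_prob_measures X. energy r \<theta> s k \<mu> \<le> ennreal (K / M)"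
proof -
  define v where "v x = ennreal (w x / M)" for x
  \<comment> \<open>\<open>point_measure\<close> lives on the subsets of \<open>P\<close>, so it is
    transported to the Borel sets of the whole space.\<close>
  define \<mu> where "\<mu> = distr (point_measure P v) borel (\<lambda>x. x)"
  have sumv: "(\<Sum>x\<in>P. v x) = 1"
  proof -
    have "(\<Sum>x\<in>P. v x) = ennreal (\<Sum>x\<in>P. w x / M)"
      unfolding v_def using w M by (subst sum_ennreal) auto
    thus ?thesis using M by (simp add: sum_divide_distrib[symmetric])
  qed
  have em: "emeasure \<mu> A = (\<Sum>x\<in>P \<inter> A. v x)" if "A \<in> sets borel" for A
    unfolding \<mu>_def using that P(1)
    by (subst emeasure_distr) (auto simp: emeasure_point_measure_finite space_point_measure Int_commute)
  have \<mu>: "\<mu> \<in> supp_prob_measures X"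
    unfolding supp_prob_measures_def
  proof (intro CollectI conjI)
    show "prob_space \<mu>"
      by (rule prob_spaceI) (simp add: em sumv \<mu>_def[THEN arg_cong[where f = space]])
    show "sets \<mu> = sets borel" by (simp add: \<mu>_def)
    have "P \<inter> - closure X = {}" using P(2) closure_subset by blast
    thus "emeasure \<mu> (- closure X) = 0" by (subst em) (auto simp: borel_open)
  qed
  note m = supp_prob_measuresD[OF \<mu>]
  interpret prob_space \<mu> by (rule m(1))
  have nn: "(\<integral>\<^sup>+x. g x \<partial>\<mu>) = (\<Sum>x\<in>P. v x * g x)" if "g \<in> borel_measurable borel" for g
    unfolding \<mu>_def using that P(1)
    by (subst nn_integral_distr) (auto simp: nn_integral_point_measure_finite)
  define a where "a x = (\<integral>\<^sup>+ y. ennreal (phi_kernel r \<theta> s k (x - y)) \<partial>\<mu>)" for x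
  have a_le: "a x \<le> ennreal (K / M)" if "x \<in> P" for x
  proof -
    have "a x = (\<Sum>y\<in>P. v y * ennreal (phi_kernel r \<theta> s k (x - y)))"
      unfolding a_def by (rule nn) measurable
    also have "\<dots> = (\<Sum>y\<in>P. ennreal (phi_kernel r \<theta> s k (x - y) * w y / M))"
      unfolding v_def using w M phi_kernel_nonneg[OF r]
      by (intro sum.cong refl, subst ennreal_mult[symmetric]) (auto simp: mult.commute)
    also have "\<dots> = ennreal (\<Sum>y\<in>P. phi_kernel r \<theta> s k (x - y) * w y / M)"
      using w M(2) phi_kernel_nonneg[OF r]
      by (intro sum_ennreal divide_nonneg_nonneg mult_nonneg_nonneg) auto
    also have "\<dots> \<le> ennreal (K / M)"
      unfolding sum_divide_distrib[symmetric] using K[OF that] M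
      by (intro ennreal_leI divide_right_mono) auto
    finally show ?thesis .
  qed
  have "energy r \<theta> s k \<mu> = (\<Sum>x\<in>P. v x * a x)"
    unfolding energy_def a_def[symmetric]
  proof (rule nn)
    show "a \<in> borel_measurable borel"
      unfolding a_def[abs_def] using m(2) by (intro potential_measurable) unfold_locales
  qed
  also have "\<dots> \<le> (\<Sum>x\<in>P. v x * ennreal (K / M))"
    using a_le by (intro sum_mono mult_left_mono) auto
  also have "\<dots> = ennreal (K / M)" by (simp add: sum_distrib_right[symmetric] sumv)
  finally show ?thesis using \<mu> by blast
qed

text \<open>Grid levels \<open>0\<close> to \<open>J\<close> correspond to diameters from
  \<open>r\<close> to \<open>r powr \<theta>\<close>. The full cells of the Frostman weights,
  enlarged to balls, form the cover; the weights, normalised, form the measure; \<open>M\<close> is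
  their total mass.\<close>

lemma frostman_cover:
  fixes X :: "'a::euclidean_space set" and r s \<theta> :: real
  assumes X: "bounded X" "X \<noteq> {}" and r: "0 < r" "r \<le> 1" and \<theta>: "\<theta> \<le> 1"
    and s: "0 \<le> s" "s \<le> DIM('a)"
    and N: "\<And>x y. x \<in> X \<Longrightarrow> y \<in> X \<Longrightarrow> dist x y < 2 ^ N * r"
  obtains U \<mu> M where "finite U" "X \<subseteq> \<Union>U" "\<And>u. u \<in> U \<Longrightarrow> bounded u"
    "\<And>u. u \<in> U \<Longrightarrow> r \<le> diameter u" "\<And>u. u \<in> U \<Longrightarrow> diameter u \<le> r powr \<theta>"
    "(\<Sum>u\<in>U. diameter u powr s) \<le> M" "M > 0" "\<mu> \<in> supp_prob_measures X"
    "energy r \<theta> s DIM('a) \<mu> \<le> ennreal (real (Suc N) * ((20 * DIM('a)) ^ DIM('a) * r powr s) / M)"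
proof -
  let ?d = "DIM('a)"
  \<comment> \<open>A cell of level \<open>j\<close> then has diameter at most
    \<open>2 ^ j * r / 2\<close> and fits into the ball of diameter \<open>2 ^ j * r\<close> around
    any of its points.\<close>
  define h where "h = r / (2 * real ?d)"
  have h: "h > 0" using r by (simp add: h_def)
  obtain B where B: "B > 0" "\<And>x. x \<in> X \<Longrightarrow> norm x \<le> B"
    using X(1) bounded_pos by blast
  have "norm x \<le> real (nat \<lceil>B / h\<rceil>) * h" if "x \<in> X" for x
    using B(2)[OF that] real_nat_ceiling_ge[of "B / h"] h by (simp add: field_simps)
  then obtain P where P: "finite P" "P \<subseteq> X" "inj_on (grid_cell h) P"
    "grid_cell h ` P = grid_cell h ` X"
    using finite_grid_net[OF h, of X "nat \<lceil>B / h\<rceil>"] by metis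
  \<comment> \<open>The last level of admissible size: \<open>r powr \<theta>\<close> lies between
    \<open>2 ^ J * r\<close> and twice that.\<close>
  obtain J where J: "2 ^ J * r \<le> r powr \<theta>" "r powr \<theta> \<le> 2 ^ Suc J * r"
  proof -
    obtain n where "r powr \<theta> / r < 2 ^ n" using real_arch_pow[of 2 "r powr \<theta> / r"] by auto
    hence n: "r powr \<theta> < 2 ^ n * r" using r by (simp add: field_simps)
    define l where "l = (LEAST n. r powr \<theta> < 2 ^ n * r)"
    have l: "r powr \<theta> < 2 ^ l * r" unfolding l_def using n by (rule LeastI)
    have "l \<noteq> 0" using l le_powr_if_le_one[OF r \<theta>] by (cases l) auto
    then obtain J where "l = Suc J" by (cases l) auto
    moreover have "\<not> r powr \<theta> < 2 ^ J * r"
      using not_less_Least[of J "\<lambda>n. r powr \<theta> < 2 ^ n * r"] \<open>l = Suc J\<close> by (simp add: l_def)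
    ultimately show thesis using l that[of J] by simp
  qed
  define q where "q j = (grid_cell (2 ^ j * h) :: 'a \<Rightarrow> _)" for j
  define m where "m j = (2 ^ j * r) powr s" for j
  have inj: "inj_on (q 0) P" using P(3) by (simp add: q_def)
  have mpos: "m j > 0" for j using r by (simp add: m_def)
  have nest: "q (Suc j) x = q (Suc j) y" if "q j x = q j y" for j x y
    using grid_cell_double_eq[of "2 ^ j * h" x y] that by (simp add: q_def mult.assoc)
  obtain w l R where w: "\<And>p. p \<in> P \<Longrightarrow> 0 \<le> w p"
    and wle: "\<And>j x. j \<le> J \<Longrightarrow> x \<in> P \<Longrightarrow> (\<Sum>y | y \<in> P \<and> q j y = q j x. w y) \<le> m j"
    and R: "R \<subseteq> P" "\<And>x. x \<in> R \<Longrightarrow> l x \<le> J" "\<And>p. p \<in> P \<Longrightarrow> \<exists>x\<in>R. q (l x) p = q (l x) x"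
    and tot: "(\<Sum>x\<in>R. m (l x)) = (\<Sum>p\<in>P. w p)"
    by (rule dyadic_frostman[of P q m J, OF P(1) inj mpos nest]) (assumption, rule that)
  define M where "M = (\<Sum>p\<in>P. w p)"
  have finR: "finite R" using R(1) P(1) finite_subset by blast
  have "P \<noteq> {}" using P(4) X(2) by auto
  hence "R \<noteq> {}" using R(3) by blast
  hence M: "M > 0" unfolding M_def tot[symmetric] using finR mpos by (intro sum_pos) auto
  define ub where "ub x = cball x (2 ^ l x * r / 2)" for x :: 'a
  have diam: "diameter (ub x) = 2 ^ l x * r" for x using r by (simp add: ub_def not_less)
  have q_mono: "q k x = q k y" if "q j x = q j y" "j \<le> k" for j k x y
    using that(2) by (induction rule: dec_induct) (auto intro: nest that)
  have pot: "(\<Sum>y\<in>P. phi_kernel r \<theta> s ?d (x - y) * w y)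
      \<le> real (Suc N) * ((20 * ?d) ^ ?d * r powr s)" if "x \<in> P" for x
    using P(1) w r(1) s J(2)
  proof (rule potential_le_if_frostman)
    show "dist x y < 2 ^ N * r" if "y \<in> P" for y using N \<open>x \<in> P\<close> that P(2) by blast
    show "(\<Sum>y | y \<in> P \<and> grid_cell (2 ^ j * (r / (2 * ?d))) y
                    = grid_cell (2 ^ j * (r / (2 * ?d))) x. w y) \<le> (2 ^ j * r) powr s"
      if "j \<le> J" "x \<in> P" for j x
      using wle[OF that] by (simp add: q_def m_def h_def)
  qed
  obtain \<mu> where \<mu>: "\<mu> \<in> supp_prob_measures X"
    "energy r \<theta> s ?d \<mu> \<le> ennreal (real (Suc N) * ((20 * ?d) ^ ?d * r powr s) / M)"
    using discrete_energy_le[OF P(1,2) w M_def[symmetric] M r(1) pot] by blast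
  show thesis
  proof (rule that[of "ub ` R" M \<mu>])
    show "finite (ub ` R)" using finR by simp
    show "X \<subseteq> \<Union>(ub ` R)"
    proof
      fix x assume "x \<in> X"
      then obtain p where p: "p \<in> P" "grid_cell h p = grid_cell h x" using P(4) by (metis imageE imageI)
      obtain y where y: "y \<in> R" "q (l y) p = q (l y) y" using R(3) p(1) by blast
      have "q (l y) x = q (l y) p" using q_mono[of 0 x p "l y"] p(2) by (simp add: q_def)
      hence "grid_cell (2 ^ l y * h) y = grid_cell (2 ^ l y * h) x" using y(2) by (simp add: q_def)
      hence "dist y x \<le> ?d * (2 ^ l y * h)" using h by (intro dist_le_if_grid_cell_eq) auto
      also have "\<dots> = 2 ^ l y * r / 2" by (simp add: h_def)
      finally show "x \<in> \<Union>(ub ` R)" using y(1) by (auto simp: ub_def)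
    qed
    show "bounded u" if "u \<in> ub ` R" for u using that by (auto simp: ub_def)
    show "r \<le> diameter u" if "u \<in> ub ` R" for u using that r by (auto simp: diam)
    show "diameter u \<le> r powr \<theta>" if u: "u \<in> ub ` R" for u
    proof -
      obtain x where x: "x \<in> R" "u = ub x" using u by blast
      have "2 ^ l x * r \<le> 2 ^ J * r" using R(2)[OF x(1)] r by (intro mult_right_mono power_increasing) auto
      thus ?thesis using J(1) x by (simp add: diam)
    qed
    have "(\<Sum>u\<in>ub ` R. diameter u powr s) \<le> (\<Sum>x\<in>R. diameter (ub x) powr s)"
      using finR sum_image_le[of R "\<lambda>u. diameter u powr s" ub] by (simp add: o_def)
    also have "\<dots> = M" unfolding M_def tot[symmetric] by (simp add: diam m_def)
    finally show "(\<Sum>u\<in>ub ` R. diameter u powr s) \<le> M" .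
  qed (use M \<mu> in auto)
qed

subsection \<open>Capacities\<close>

lemma exists_energy_le_one:
  fixes X :: "'a::euclidean_space set"
  assumes "X \<noteq> {}" "0 < r" "0 \<le> s" "s \<le> real k"
  shows "\<exists>\<mu>\<in>supp_prob_measures X. energy r \<theta> s k \<mu> \<le> 1"
proof -
  obtain x where x: "x \<in> X" using assms(1) by blast
  have "\<exists>\<mu>\<in>supp_prob_measures X. energy r \<theta> s k \<mu> \<le> ennreal (1 / 1)"
    using x assms by (intro discrete_energy_le[of "{x}" X "\<lambda>_. 1"]) (auto simp: phi_kernel_le_one)
  thus ?thesis by simp
qed

text \<open>The infimum of the energies lies between \<open>a\<close> and 1, so neither
  \<open>inverse 0 = 0\<close> nor \<open>enn2real top = 0\<close> can interfere.\<close>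

lemma capacity_le_inverse:
  fixes X :: "'a::euclidean_space set"
  assumes "X \<noteq> {}" "0 < r" "0 \<le> s" "s \<le> real k" "a > 0"
    and "\<And>\<mu>. \<mu> \<in> supp_prob_measures X \<Longrightarrow> ennreal a \<le> energy r \<theta> s k \<mu>"
  shows "capacity r \<theta> s k X \<le> 1 / a" "1 \<le> capacity r \<theta> s k X"
proof -
  define I where "I = (INF \<mu>\<in>supp_prob_measures X. energy r \<theta> s k \<mu>)"
  have "ennreal a \<le> I" unfolding I_def using assms(6) by (rule INF_greatest)
  moreover have I1: "I \<le> 1"
    unfolding I_def using exists_energy_le_one[OF assms(1-4), of \<theta>] by (auto intro: INF_lower2)
  moreover have "I < top" using I1 by (rule order.strict_trans1) simp
  ultimately have "a \<le> enn2real I" "enn2real I \<le> 1"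
    using assms(5) enn2real_mono[of "ennreal a" I] by (auto intro: enn2real_leI)
  thus "capacity r \<theta> s k X \<le> 1 / a" "1 \<le> capacity r \<theta> s k X"
    unfolding capacity_def I_def[symmetric] using assms(5) by (auto simp: field_simps)
qed

text \<open>Positivity of the capacity excludes an infimum with real value 0, whose reciprocal would
  be the default \<open>inverse 0 = 0\<close>.\<close>

lemma capacity_ge_inverse:
  assumes "\<mu> \<in> supp_prob_measures X" "energy r \<theta> s k \<mu> \<le> ennreal a" "a \<ge> 0"
    and "capacity r \<theta> s k X > 0"
  shows "1 / a \<le> capacity r \<theta> s k X"
proof -
  define I where "I = (INF \<mu>\<in>supp_prob_measures X. energy r \<theta> s k \<mu>)"
  have "I \<le> ennreal a" unfolding I_def using assms(1,2) by (rule INF_lower2)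
  hence "enn2real I \<le> a" using assms(3) by (intro enn2real_leI)
  moreover have "enn2real I > 0" using assms(4) by (simp add: capacity_def I_def)
  ultimately show ?thesis by (simp add: capacity_def I_def[symmetric] field_simps)
qed

lemma capacity_le_cover:
  fixes X :: "'a::euclidean_space set"
  assumes X: "X \<noteq> {}" and r: "0 < r" and s: "0 \<le> s" "s \<le> real k"
    and U: "finite U" "X \<subseteq> \<Union>U"
    and diam: "\<And>u. u \<in> U \<Longrightarrow> bounded u" "\<And>u. u \<in> U \<Longrightarrow> r \<le> diameter u"
      "\<And>u. u \<in> U \<Longrightarrow> diameter u \<le> r powr \<theta>"
  shows "capacity r \<theta> s k X \<le> (\<Sum>u\<in>U. diameter u powr s) / r powr s"
    "1 \<le> capacity r \<theta> s k X"
proof -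
  define S where "S = (\<Sum>u\<in>U. diameter u powr s)"
  have "U \<noteq> {}" using X U(2) by auto
  hence S: "S > 0" unfolding S_def using U(1) diam(2) r by (intro sum_pos) (force simp: powr_def)+
  have e: "ennreal (r powr s / S) \<le> energy r \<theta> s k \<mu>" if "\<mu> \<in> supp_prob_measures X" for \<mu>
    unfolding S_def using energy_ge_if_cover[OF that r s(1) U diam] .
  show "1 \<le> capacity r \<theta> s k X"
    using capacity_le_inverse(2)[OF X r s _ e] S r by simp
  show "capacity r \<theta> s k X \<le> (\<Sum>u\<in>U. diameter u powr s) / r powr s"
    using capacity_le_inverse(1)[OF X r s _ e] S r by (simp add: S_def)
qed

text \<open>Balls of diameter \<open>r\<close> form an admissible cover, which keeps the infimum of
  the energies positive; a point mass keeps it at most 1.\<close>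

lemma capacity_ge_one:
  fixes X :: "'a::euclidean_space set"
  assumes "bounded X" "X \<noteq> {}" "0 < r" "r \<le> 1" "\<theta> \<le> 1" "0 \<le> s" "s \<le> real k"
  shows "1 \<le> capacity r \<theta> s k X"
proof -
  obtain U where U: "finite U" "X \<subseteq> \<Union>U" "\<And>u. u \<in> U \<Longrightarrow> bounded u \<and> diameter u = r"
    using uniform_cover[OF assms(1)] assms(3,4) by metis
  show ?thesis
    by (rule capacity_le_cover(2)[OF assms(2,3,6,7) U(1,2)])
       (use U(3) le_powr_if_le_one[OF assms(3-5)] in auto)
qed

text \<open>The two pointwise kernel comparisons pass to energies and then to the infimum over
  measures.\<close>

lemma capacity_mono:
  fixes X :: "'a::euclidean_space set"
  assumes X: "bounded X" "X \<noteq> {}" and r: "0 < r" "r \<le> 1" and \<theta>: "\<theta> \<le> 1"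
    and ts: "0 \<le> t" "t \<le> s" "s \<le> real k"
  shows "capacity r \<theta> t k X \<le> capacity r \<theta> s k X"
    and "capacity r \<theta> s k X \<le> r powr - ((1 - \<theta>) * (s - t)) * capacity r \<theta> t k X"
proof -
  define I where "I v = (INF \<mu>\<in>supp_prob_measures X. energy r \<theta> v k \<mu>)" for v
  define e where "e v = enn2real (I v)" for v
  define \<kappa> where "\<kappa> = r powr - ((1 - \<theta>) * (s - t))"
  have \<kappa>: "\<kappa> > 0" using r by (simp add: \<kappa>_def)
  \<comment> \<open>As \<open>inverse (e v)\<close> is at least 1, \<open>e v\<close> is positive,
    and a positive \<open>enn2real\<close> also excludes \<open>top\<close>.\<close>
  have e: "e v > 0" "I v = ennreal (e v)" if "0 \<le> v" "v \<le> real k" for v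
  proof -
    have "1 \<le> inverse (e v)"
      using capacity_ge_one[OF X r \<theta> that] by (simp add: capacity_def e_def I_def)
    thus "e v > 0" by (cases "e v > 0") (auto simp: e_def not_less dest: order.antisym[OF _ enn2real_nonneg])
    hence "I v < top" by (auto simp: e_def enn2real_positive_iff)
    thus "I v = ennreal (e v)" by (simp add: e_def)
  qed
  have cap: "capacity r \<theta> v k X = inverse (e v)" for v by (simp add: capacity_def e_def I_def)
  have "I s \<le> I t"
    unfolding I_def energy_def using phi_kernel_antimono[OF r \<theta> ts(1,2)]
    by (intro INF_mono, elim rev_bexI, intro nn_integral_mono ennreal_leI)
  hence "e s \<le> e t" using e[of s] e[of t] ts by (simp add: ennreal_le_iff)
  thus "capacity r \<theta> t k X \<le> capacity r \<theta> s k X"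
    using e[of s] ts by (simp add: cap le_imp_inverse_le)
  have "ennreal (e t / \<kappa>) \<le> energy r \<theta> s k \<mu>" if \<mu>: "\<mu> \<in> supp_prob_measures X" for \<mu>
  proof -
    have [measurable_cong]: "sets \<mu> = sets borel" using supp_prob_measuresD(2)[OF \<mu>] .
    interpret prob_space \<mu> using supp_prob_measuresD(1)[OF \<mu>] .
    have "ennreal (e t) = I t" using e ts by simp
    also have "\<dots> \<le> energy r \<theta> t k \<mu>" unfolding I_def using \<mu> by (rule INF_lower)
    also have "\<dots> \<le> (\<integral>\<^sup>+ x. (\<integral>\<^sup>+ y. ennreal \<kappa> * ennreal (phi_kernel r \<theta> s k (x - y)) \<partial>\<mu>) \<partial>\<mu>)"
      unfolding energy_def
    proof (intro nn_integral_mono)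
      fix x y
      show "ennreal (phi_kernel r \<theta> t k (x - y)) \<le> ennreal \<kappa> * ennreal (phi_kernel r \<theta> s k (x - y))"
        using phi_kernel_le_mult[OF r \<theta> ts(2), of k "x - y"] \<kappa> phi_kernel_nonneg[OF r(1)]
        by (subst ennreal_mult[symmetric]) (auto simp: \<kappa>_def[symmetric] ennreal_leI)
    qed
    also have "\<dots> = (\<integral>\<^sup>+ x. ennreal \<kappa> * (\<integral>\<^sup>+ y. ennreal (phi_kernel r \<theta> s k (x - y)) \<partial>\<mu>) \<partial>\<mu>)"
      by (intro nn_integral_cong nn_integral_cmult) measurable
    also have "\<dots> = ennreal \<kappa> * energy r \<theta> s k \<mu>"
      unfolding energy_def by (intro nn_integral_cmult) measurable
    finally have "ennreal (1 / \<kappa>) * ennreal (e t) \<le> ennreal (1 / \<kappa>) * (ennreal \<kappa> * energy r \<theta> s k \<mu>)"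
      by (rule mult_left_mono) simp
    moreover have "ennreal (1 / \<kappa>) * (ennreal \<kappa> * energy r \<theta> s k \<mu>) = energy r \<theta> s k \<mu>"
      using \<kappa> by (simp add: mult.assoc[symmetric] ennreal_mult[symmetric])
    moreover have "ennreal (1 / \<kappa>) * ennreal (e t) = ennreal (e t / \<kappa>)"
      using \<kappa> e[of t] ts by (simp add: ennreal_mult[symmetric])
    ultimately show ?thesis by simp
  qed
  hence "capacity r \<theta> s k X \<le> 1 / (e t / \<kappa>)"
    using e[of t] ts \<kappa> by (intro capacity_le_inverse(1)[OF X(2) r(1)]) auto
  thus "capacity r \<theta> s k X \<le> r powr - ((1 - \<theta>) * (s - t)) * capacity r \<theta> t k X"
    by (simp add: cap \<kappa>_def[symmetric] divide_inverse mult.commute)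
qed

text \<open>The diameter of an unbounded set is the junk value \<open>Sup\<close> of an unbounded set of reals,
  which is the same for all of them.\<close>

lemma bounded_if_small_diameter:
  obtains c :: real where "c > 0"
    "\<And>u :: 'a::metric_space set. 0 < diameter u \<Longrightarrow> diameter u < c \<Longrightarrow> bounded u"
proof -
  define j where "j = (LEAST z::real. False)"
  have junk: "diameter u = j" if "\<not> bounded u" for u :: "'a set"
  proof -
    have "u \<noteq> {}" using that by auto
    \<comment> \<open>No real bounds the distances, so the \<open>LEAST\<close> in the definition of
      \<open>Sup\<close> is that of an always false predicate.\<close>
    have eq: "(\<forall>a\<in>(\<lambda>(x, y). dist x y) ` (u \<times> u). a \<le> z) \<longleftrightarrow> False" for z
      using that by (force simp: bounded_two_points)
    show ?thesis using \<open>u \<noteq> {}\<close> unfolding diameter_def Sup_real_def j_def eq by simp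
  qed
  show thesis
  \<comment> \<open>If \<open>j > 0\<close>, the bound \<open>diameter u < j\<close> excludes the
    junk value; otherwise positivity of the diameter does.\<close>
  proof (rule that[of "if j > 0 then j else 1"])
    show "bounded u" if "0 < diameter u" "diameter u < (if j > 0 then j else 1)" for u :: "'a set"
      using that junk[of u] by (cases "bounded u") auto
  qed simp
qed

section \<open>Covers in terms of the smallest admissible diameter\<close>

text \<open>Substituting \<open>r = \<delta> powr \<theta>\<close> makes the least admissible
  diameter equal to the kernel scale \<open>\<delta>\<close>. Covers are finite, since infinitely
  many terms of size at least \<open>\<delta> powr s\<close> are not summable.\<close>

lemma int_cover_powr_iff:
  fixes X :: "'a::euclidean_space set"
  assumes "0 < \<delta>" "0 < \<theta>" "0 \<le> s"
  shows "int_cover X \<theta> (\<delta> powr \<theta>) s \<epsilon> U \<longleftrightarrow> finite U \<and> X \<subseteq> \<Union>U \<and>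
    (\<forall>u\<in>U. \<delta> \<le> diameter u \<and> diameter u \<le> \<delta> powr \<theta>) \<and> (\<Sum>u\<in>U. diameter u powr s) \<le> \<epsilon>"
proof -
  have eq: "(\<delta> powr \<theta>) powr (1 / \<theta>) = \<delta>" using assms by (simp add: powr_powr)
  have "finite U" if U: "\<forall>u\<in>U. \<delta> \<le> diameter u" "(\<lambda>u. diameter u powr s) summable_on U"
  proof (rule ccontr)
    assume inf: "infinite U"
    define I where "I = (\<Sum>\<^sub>\<infinity>u\<in>U. diameter u powr s)"
    obtain n where n: "I < real n * \<delta> powr s"
      using reals_Archimedean3[of "\<delta> powr s"] assms(1) by fastforce
    obtain F where F: "F \<subseteq> U" "finite F" "card F = n"
      using infinite_arbitrarily_large[OF inf, of n] by blast
    have "real n * \<delta> powr s = (\<Sum>u\<in>F. \<delta> powr s)" using F by simp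
    also have "\<dots> \<le> (\<Sum>u\<in>F. diameter u powr s)"
      using F U(1) assms by (intro sum_mono powr_mono2) auto
    also have "\<dots> \<le> I" unfolding I_def using U(2) F by (intro finite_sum_le_infsum) auto
    finally show False using n by simp
  qed
  thus ?thesis unfolding int_cover_def eq by (auto intro: countable_finite)
qed

text \<open>The substitution is an increasing bijection of the positive reals preserving convergence
  to 0, so quantifiers over small \<open>r\<close> become filter statements in
  \<open>\<delta>\<close>.\<close>

lemma eventually_at_right_powr_iff:
  fixes P :: "real \<Rightarrow> bool" and \<theta> :: real
  assumes "0 < \<theta>"
  shows "(\<exists>r0>0. \<forall>r. 0 < r \<and> r \<le> r0 \<longrightarrow> P r) \<longleftrightarrow> (\<forall>\<^sub>F \<delta> in at_right 0. P (\<delta> powr \<theta>))"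
proof
  assume "\<exists>r0>0. \<forall>r. 0 < r \<and> r \<le> r0 \<longrightarrow> P r"
  then obtain r0 where r0: "r0 > 0" "\<And>r. 0 < r \<Longrightarrow> r \<le> r0 \<Longrightarrow> P r" by blast
  show "\<forall>\<^sub>F \<delta> in at_right 0. P (\<delta> powr \<theta>)"
    unfolding eventually_at_right_field
  proof (intro exI[of _ "r0 powr (1 / \<theta>)"] conjI allI impI)
    fix y assume y: "0 < y" "y < r0 powr (1 / \<theta>)"
    have "y powr \<theta> \<le> (r0 powr (1 / \<theta>)) powr \<theta>" using y assms by (intro powr_mono2) auto
    thus "P (y powr \<theta>)" using r0 y assms by (auto simp: powr_powr)
  qed (use r0 in auto)
next
  assume "\<forall>\<^sub>F \<delta> in at_right 0. P (\<delta> powr \<theta>)"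
  then obtain b where b: "b > 0" "\<And>y. 0 < y \<Longrightarrow> y < b \<Longrightarrow> P (y powr \<theta>)"
    unfolding eventually_at_right_field by blast
  show "\<exists>r0>0. \<forall>r. 0 < r \<and> r \<le> r0 \<longrightarrow> P r"
  proof (intro exI[of _ "(b / 2) powr \<theta>"] conjI allI impI)
    fix r assume r: "0 < r \<and> r \<le> (b / 2) powr \<theta>"
    have "r powr (1 / \<theta>) \<le> ((b / 2) powr \<theta>) powr (1 / \<theta>)" using r assms by (intro powr_mono2) auto
    also have "\<dots> = b / 2" using assms b by (simp add: powr_powr)
    finally have "r powr (1 / \<theta>) < b" using b by simp
    from b(2)[OF _ this] show "P r" using r assms by (simp add: powr_powr)
  qed (use b in auto)
qed

lemma frequently_at_right_powr_iff:
  fixes P :: "real \<Rightarrow> bool" and \<theta> :: real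
  assumes "0 < \<theta>"
  shows "(\<forall>r0>0. \<exists>r. 0 < r \<and> r \<le> r0 \<and> P r) \<longleftrightarrow> (\<exists>\<^sub>F \<delta> in at_right 0. P (\<delta> powr \<theta>))"
  using eventually_at_right_powr_iff[OF assms, of "\<lambda>r. \<not> P r"]
  unfolding frequently_def by blast

subsection \<open>The profile as a critical exponent\<close>

text \<open>\<open>Q s\<close> stands for admissibility of \<open>s\<close> for covers,
  \<open>F s\<close> for the limit of the capacity exponents. Below the infimum \<open>D\<close> one
  has \<open>F s \<ge> s\<close>, above it \<open>F s \<le> s\<close>, and monotonicity forces
  \<open>F D = D\<close>; \<open>F0\<close> and \<open>Fd\<close> replace the missing side at an
  endpoint. The Lipschitz constant \<open>1 - \<theta> < 1\<close> makes the fixed point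
  unique.\<close>

lemma Inf_eq_fixed_point:
  fixes F :: "real \<Rightarrow> ereal" and Q :: "real \<Rightarrow> bool"
  assumes d: "0 \<le> d" and \<theta>: "0 < \<theta>"
    and Q_mono: "\<And>s t. 0 \<le> s \<Longrightarrow> s \<le> t \<Longrightarrow> Q s \<Longrightarrow> Q t" and Q_large: "\<And>s. d < s \<Longrightarrow> Q s"
    and F_le: "\<And>s. 0 \<le> s \<Longrightarrow> s \<le> d \<Longrightarrow> Q s \<Longrightarrow> F s \<le> ereal s"
    and F_ge: "\<And>s. 0 \<le> s \<Longrightarrow> s \<le> d \<Longrightarrow> \<not> Q s \<Longrightarrow> ereal s \<le> F s"
    and F0: "0 \<le> F 0" and Fd: "F d \<le> ereal d"
    and F_mono: "\<And>t s. 0 \<le> t \<Longrightarrow> t \<le> s \<Longrightarrow> s \<le> d \<Longrightarrow> F t \<le> F s"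
    and F_lip: "\<And>t s. 0 \<le> t \<Longrightarrow> t \<le> s \<Longrightarrow> s \<le> d \<Longrightarrow> F s \<le> F t + ereal ((1 - \<theta>) * (s - t))"
  shows "Inf {s. 0 \<le> s \<and> Q s} = (THE s. 0 \<le> s \<and> s \<le> d \<and> F s = ereal s)"
proof -
  define A where "A = {s. 0 \<le> s \<and> Q s}"
  define D where "D = Inf A"
  have ne: "A \<noteq> {}" using Q_large[of "d + 1"] d by (auto simp: A_def intro!: exI[of _ "d + 1"])
  have bdd: "bdd_below A" by (auto simp: A_def)
  have D0: "0 \<le> D" unfolding D_def using ne by (intro cInf_greatest) (auto simp: A_def)
  have Dd: "D \<le> d"
  proof (rule dense_ge)
    fix s assume "d < s"
    thus "D \<le> s" unfolding D_def using bdd Q_large d by (intro cInf_lower) (auto simp: A_def)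
  qed
  have above: "F s \<le> ereal s" if s: "D < s" "s \<le> d" for s
  proof -
    obtain a where "a \<in> A" "a < s" using cInf_lessD[OF ne, of s] s(1) unfolding D_def by blast
    thus ?thesis using s D0 Q_mono[of a s] by (intro F_le) (auto simp: A_def)
  qed
  have below: "ereal s \<le> F s" if "0 \<le> s" "s < D" for s
  proof -
    have "s \<notin> A" using that(2) cInf_lower[OF _ bdd, of s] by (auto simp: D_def)
    thus ?thesis using that Dd by (intro F_ge) (auto simp: A_def)
  qed
  have "F D \<le> ereal D"
  proof (cases "D = d")
    case False
    show ?thesis
    proof (rule ccontr)
      assume "\<not> F D \<le> ereal D"
      then obtain z where z: "ereal D < ereal z" "ereal z < F D"
        using ereal_dense2[of "ereal D" "F D"] by (auto simp: not_le)
      \<comment> \<open>At \<open>min z d\<close>, monotonicity keeps \<open>F\<close> above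
        \<open>z\<close>, while \<open>above\<close> forces it down to at most
        \<open>z\<close>.\<close>
      have "F D \<le> F (min z d)" using z D0 Dd by (intro F_mono) auto
      also have "\<dots> \<le> ereal (min z d)" using z False Dd by (intro above) auto
      also have "\<dots> \<le> ereal z" by simp
      finally show False using z by simp
    qed
  qed (use Fd in simp)
  moreover have "ereal D \<le> F D"
  proof (cases "D = 0")
    case False
    show ?thesis
    proof (rule ccontr)
      assume "\<not> ereal D \<le> F D"
      then obtain z where z: "F D < ereal z" "ereal z < ereal D"
        using ereal_dense2[of "F D" "ereal D"] by (auto simp: not_le)
      have "ereal z \<le> ereal (max z 0)" by simp
      also have "\<dots> \<le> F (max z 0)" using z False D0 by (intro below) auto
      also have "\<dots> \<le> F D" using z D0 Dd by (intro F_mono) auto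
      finally show False using z by simp
    qed
  qed (use F0 in \<open>simp add: zero_ereal_def\<close>)
  ultimately have FD: "F D = ereal D" by simp
  have uniq: False if "0 \<le> t" "t < s" "s \<le> d" "F t = ereal t" "F s = ereal s" for s t
  proof -
    have "s \<le> t + (1 - \<theta>) * (s - t)" using F_lip[of t s] that by simp
    hence "\<theta> * (s - t) \<le> 0" by (simp add: algebra_simps)
    moreover have "\<theta> * (s - t) > 0" using that \<theta> by simp
    ultimately show False by linarith
  qed
  have "(THE s. 0 \<le> s \<and> s \<le> d \<and> F s = ereal s) = D"
  proof (rule the_equality)
    fix s assume "0 \<le> s \<and> s \<le> d \<and> F s = ereal s"
    thus "s = D" using uniq[of s D] uniq[of D s] FD D0 Dd by (cases s D rule: linorder_cases) auto
  qed (use D0 Dd FD in auto)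
  thus ?thesis by (simp add: D_def A_def)
qed

section \<open>Capacity exponents and covering sums\<close>

context
  fixes X :: "'a::euclidean_space set" and \<theta> :: real
  assumes X: "bounded X" "X \<noteq> {}" and \<theta>: "0 < \<theta>" "\<theta> \<le> 1"
begin

definition cap_exponent :: "real \<Rightarrow> real \<Rightarrow> real" where
  "cap_exponent s \<delta> = ln (capacity \<delta> \<theta> s DIM('a) X) / - ln \<delta>"

definition has_cover :: "real \<Rightarrow> real \<Rightarrow> real \<Rightarrow> bool" where
  "has_cover s \<epsilon> \<delta> \<longleftrightarrow> (\<exists>U. int_cover X \<theta> (\<delta> powr \<theta>) s \<epsilon> U)"

lemma eventually_unit: "\<forall>\<^sub>F \<delta> in at_right (0::real). 0 < \<delta> \<and> \<delta> < 1"
  unfolding eventually_at_right_field by (intro exI[of _ 1]) auto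

text \<open>Eventually all diameters are at most 1, so raising the exponent lowers every term and
  the same cover serves.\<close>

lemma has_cover_mono:
  assumes "0 \<le> s" "s \<le> t"
  shows "\<forall>\<^sub>F \<delta> in at_right 0. has_cover s \<epsilon> \<delta> \<longrightarrow> has_cover t \<epsilon> \<delta>"
  using eventually_unit
proof eventually_elim
  case (elim \<delta>)
  show ?case
  proof
    assume "has_cover s \<epsilon> \<delta>"
    then obtain U where U: "finite U" "X \<subseteq> \<Union>U" "(\<Sum>u\<in>U. diameter u powr s) \<le> \<epsilon>"
      "\<And>u. u \<in> U \<Longrightarrow> \<delta> \<le> diameter u" "\<And>u. u \<in> U \<Longrightarrow> diameter u \<le> \<delta> powr \<theta>"
      using elim \<theta> assms by (auto simp: has_cover_def int_cover_powr_iff)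
    have "\<delta> powr \<theta> \<le> 1" using elim \<theta> by (intro powr_le1) auto
    hence "(\<Sum>u\<in>U. diameter u powr t) \<le> (\<Sum>u\<in>U. diameter u powr s)"
      using U(4,5) elim assms by (intro sum_mono powr_mono') (force intro: order.trans)+
    thus "has_cover t \<epsilon> \<delta>"
      using U elim \<theta> assms by (auto simp: has_cover_def int_cover_powr_iff intro!: exI[of _ U])
  qed
qed

text \<open>A covering sum of at most 1 bounds the capacity by \<open>1 / \<delta> powr s\<close>.
  Boundedness of the covering sets comes from their small diameters, once
  \<open>\<delta> powr \<theta> < c\<close>.\<close>

lemma cap_exponent_le_if_has_cover:
  assumes "0 \<le> s" "s \<le> real DIM('a)"
  shows "\<forall>\<^sub>F \<delta> in at_right 0. has_cover s 1 \<delta> \<longrightarrow> cap_exponent s \<delta> \<le> s"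
proof -
  obtain c where c: "c > 0" "\<And>u :: 'a set. 0 < diameter u \<Longrightarrow> diameter u < c \<Longrightarrow> bounded u"
    using bounded_if_small_diameter by blast
  have "\<forall>\<^sub>F \<delta> in at_right 0. \<delta> powr \<theta> < c"
    using c(1) \<theta> by (subst eventually_at_right_powr_iff[symmetric]) (auto intro!: exI[of _ "c / 2"])
  with eventually_unit show ?thesis
  proof eventually_elim
    case (elim \<delta>)
    show ?case
    proof
      assume "has_cover s 1 \<delta>"
      then obtain U where U: "finite U" "X \<subseteq> \<Union>U" "(\<Sum>u\<in>U. diameter u powr s) \<le> 1"
        "\<And>u. u \<in> U \<Longrightarrow> \<delta> \<le> diameter u" "\<And>u. u \<in> U \<Longrightarrow> diameter u \<le> \<delta> powr \<theta>"
        using elim \<theta> assms by (auto simp: has_cover_def int_cover_powr_iff)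
      have "bounded u" if "u \<in> U" for u using c(2)[of u] U(4,5)[OF that] elim by linarith
      note cap = capacity_le_cover[OF X(2) _ assms U(1,2) this U(4,5), simplified]
      have "capacity \<delta> \<theta> s DIM('a) X \<le> 1 / \<delta> powr s"
        using cap(1) U(3) elim by (meson divide_right_mono order.trans powr_ge_zero)
      hence "ln (capacity \<delta> \<theta> s DIM('a) X) \<le> ln (1 / \<delta> powr s)"
        using cap(2) elim by (intro ln_mono) auto
      also have "\<dots> = s * - ln \<delta>" using elim by (simp add: ln_div ln_powr)
      finally show "cap_exponent s \<delta> \<le> s"
        unfolding cap_exponent_def using elim by (subst pos_divide_le_eq) auto
    qed
  qed
qed

text \<open>If no cover has sum at most \<open>\<epsilon>\<close>, the Frostman construction gives
  total mass \<open>M > \<epsilon>\<close>, hence capacity at least a constant times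
  \<open>1 / \<delta> powr s\<close> divided by the number of scales. This number is logarithmic in
  \<open>1 / \<delta>\<close>, so its effect on the exponent vanishes.\<close>

lemma cap_exponent_ge_if_not_has_cover:
  assumes s: "0 \<le> s" "s \<le> real DIM('a)" and \<epsilon>: "\<epsilon> > 0"
  obtains err where "(err \<longlongrightarrow> 0) (at_right 0)"
    "\<forall>\<^sub>F \<delta> in at_right 0. \<not> has_cover s \<epsilon> \<delta> \<longrightarrow> s + err \<delta> \<le> cap_exponent s \<delta>"
proof -
  obtain e where e: "\<And>x y. x \<in> X \<Longrightarrow> y \<in> X \<Longrightarrow> dist x y \<le> e"
    using X(1) unfolding bounded_two_points by blast
  define B where "B = \<bar>e\<bar> + 1"
  have B: "B \<ge> 1" "\<And>x y. x \<in> X \<Longrightarrow> y \<in> X \<Longrightarrow> dist x y < B"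
    using e by (force simp: B_def)+
  define A :: real where "A = (20 * DIM('a)) ^ DIM('a)"
  have A: "A > 0" by (simp add: A_def)
  \<comment> \<open>The numerator collects the constants and the bound
    \<open>log 2 (B / \<delta>) + 2\<close> for \<open>Suc N\<close>, where \<open>N\<close> is the
    logarithm rounded up.\<close>
  define err where "err \<delta> = (ln (\<epsilon> / A) - ln (log 2 (B / \<delta>) + 2)) / - ln \<delta>" for \<delta>
  have "B > 0" using B by simp
  hence "(err \<longlongrightarrow> 0) (at_right 0)" unfolding err_def[abs_def] log_def by real_asymp
  moreover have "\<forall>\<^sub>F \<delta> in at_right 0. \<not> has_cover s \<epsilon> \<delta> \<longrightarrow> s + err \<delta> \<le> cap_exponent s \<delta>"
    using eventually_unit
  proof eventually_elim
    case (elim \<delta>)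
    show ?case
    proof
      assume no: "\<not> has_cover s \<epsilon> \<delta>"
      define l where "l = log 2 (B / \<delta>)"
      have B\<delta>: "B / \<delta> \<ge> 1" using B elim by (simp add: le_divide_eq)
      hence l: "l \<ge> 0" by (simp add: l_def)
      define N where "N = nat \<lceil>l\<rceil>"
      have "real N = of_int \<lceil>l\<rceil>" using l by (simp add: N_def)
      hence N: "l \<le> real N" "real N \<le> l + 1" by linarith+
      have "B / \<delta> = 2 powr l" using B\<delta> by (simp add: l_def)
      also have "\<dots> \<le> 2 powr real N" using N by (intro powr_mono) auto
      also have "\<dots> = 2 ^ N" by (simp add: powr_realpow)
      finally have "B \<le> 2 ^ N * \<delta>" using elim by (simp add: field_simps)
      hence dist: "dist x y < 2 ^ N * \<delta>" if "x \<in> X" "y \<in> X" for x y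
        using B(2)[OF that] by simp
      have \<delta>: "0 < \<delta>" "\<delta> \<le> 1" using elim by auto
      obtain U \<mu> M where U: "finite U" "X \<subseteq> \<Union>U"
        "\<And>u. u \<in> U \<Longrightarrow> \<delta> \<le> diameter u" "\<And>u. u \<in> U \<Longrightarrow> diameter u \<le> \<delta> powr \<theta>"
        "(\<Sum>u\<in>U. diameter u powr s) \<le> M" "M > 0" "\<mu> \<in> supp_prob_measures X"
        "energy \<delta> \<theta> s DIM('a) \<mu> \<le> ennreal (real (Suc N) * (A * \<delta> powr s) / M)"
        unfolding A_def using frostman_cover[OF X \<delta> \<theta>(2) s dist] by metis
      have "\<epsilon> < M"
      proof (rule ccontr)
        assume "\<not> \<epsilon> < M"
        hence "(\<Sum>u\<in>U. diameter u powr s) \<le> \<epsilon>" using U(5) by simp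
        hence "int_cover X \<theta> (\<delta> powr \<theta>) s \<epsilon> U"
          using U(1-4) \<delta> \<theta> s by (simp add: int_cover_powr_iff)
        thus False using no by (auto simp: has_cover_def)
      qed
      have cap1: "1 \<le> capacity \<delta> \<theta> s DIM('a) X"
        by (rule capacity_ge_one[OF X \<delta> \<theta>(2) s])
      have "\<epsilon> / (A * (l + 2) * \<delta> powr s) \<le> M / (A * real (Suc N) * \<delta> powr s)"
        using \<open>\<epsilon> < M\<close> \<epsilon> A N l \<delta> by (intro frac_le mult_right_mono mult_left_mono) auto
      also have "\<dots> = 1 / (real (Suc N) * (A * \<delta> powr s) / M)" by simp
      also have "\<dots> \<le> capacity \<delta> \<theta> s DIM('a) X"
        using cap1 A U(6) by (intro capacity_ge_inverse[OF U(7,8)]) auto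
      finally have "ln (\<epsilon> / (A * (l + 2) * \<delta> powr s)) \<le> ln (capacity \<delta> \<theta> s DIM('a) X)"
        using \<epsilon> A l \<delta> by (intro ln_mono) auto
      also have "ln (\<epsilon> / (A * (l + 2) * \<delta> powr s)) = ln (\<epsilon> / A) - ln (l + 2) - s * ln \<delta>"
        using \<epsilon> A l \<delta> by (simp add: ln_div ln_mult ln_powr)
      finally have "(s * - ln \<delta> + (ln (\<epsilon> / A) - ln (l + 2))) / - ln \<delta> \<le> cap_exponent s \<delta>"
        unfolding cap_exponent_def using elim by (intro divide_right_mono) auto
      thus "s + err \<delta> \<le> cap_exponent s \<delta>"
        using elim by (simp add: err_def l_def add_divide_distrib[symmetric] field_simps)
    qed
  qed
  ultimately show thesis by (rule that)
qed

text \<open>The cover by balls of diameter \<open>\<delta>\<close> has sum at most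
  \<open>c * \<delta> powr (s - DIM('a))\<close>, which tends to 0.\<close>

lemma has_cover_if_gt_DIM:
  assumes s: "real DIM('a) < s" and \<epsilon>: "\<epsilon> > 0"
  shows "\<forall>\<^sub>F \<delta> in at_right 0. has_cover s \<epsilon> \<delta>"
proof -
  obtain c where c: "c > 0" "\<And>r. 0 < r \<Longrightarrow> r \<le> 1 \<Longrightarrow>
    \<exists>U. finite U \<and> X \<subseteq> \<Union>U \<and> (\<forall>u\<in>U. bounded u \<and> diameter u = r) \<and> real (card U) * r ^ DIM('a) \<le> c"
    using uniform_cover[OF X(1)] by blast
  define a where "a = s - DIM('a)"
  have a: "a > 0" using s by (simp add: a_def)
  have "((\<lambda>\<delta>. c * \<delta> powr a) \<longlongrightarrow> 0) (at_right 0)" using a c(1) by real_asymp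
  hence "\<forall>\<^sub>F \<delta> in at_right 0. c * \<delta> powr a < \<epsilon>" using \<epsilon> by (rule order_tendstoD(2))
  with eventually_unit show ?thesis
  proof eventually_elim
    case (elim \<delta>)
    then obtain U where U: "finite U" "X \<subseteq> \<Union>U" "\<And>u. u \<in> U \<Longrightarrow> diameter u = \<delta>"
      "real (card U) * \<delta> ^ DIM('a) \<le> c" using c(2)[of \<delta>] by auto
    have "(\<Sum>u\<in>U. diameter u powr s) = real (card U) * \<delta> powr s" using U(3) by simp
    also have "\<delta> powr s = \<delta> ^ DIM('a) * \<delta> powr a"
      using elim by (simp add: a_def powr_diff powr_realpow)
    also have "real (card U) * \<dots> \<le> c * \<delta> powr a"
      unfolding mult.assoc[symmetric] using U(4) by (rule mult_right_mono) simp
    finally have "(\<Sum>u\<in>U. diameter u powr s) \<le> \<epsilon>" using elim by simp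
    thus ?case
      using U elim \<theta> s le_powr_if_le_one[of \<delta> \<theta>]
      by (auto simp: has_cover_def int_cover_powr_iff intro!: exI[of _ U])
  qed
qed

text \<open>For the right endpoint of the fixed point argument: at exponent \<open>DIM('a)\<close>
  the covering sums of the balls stay bounded by \<open>c\<close>, which costs only
  \<open>ln c / - ln \<delta>\<close>.\<close>

lemma cap_exponent_DIM_le:
  obtains err where "(err \<longlongrightarrow> 0) (at_right 0)"
    "\<forall>\<^sub>F \<delta> in at_right 0. cap_exponent DIM('a) \<delta> \<le> real DIM('a) + err \<delta>"
proof -
  obtain c where c: "c > 0" "\<And>r. 0 < r \<Longrightarrow> r \<le> 1 \<Longrightarrow>
    \<exists>U. finite U \<and> X \<subseteq> \<Union>U \<and> (\<forall>u\<in>U. bounded u \<and> diameter u = r) \<and> real (card U) * r ^ DIM('a) \<le> c"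
    using uniform_cover[OF X(1)] by blast
  have "((\<lambda>\<delta>. ln c / - ln \<delta>) \<longlongrightarrow> 0) (at_right 0)" by real_asymp
  moreover have "\<forall>\<^sub>F \<delta> in at_right 0. cap_exponent DIM('a) \<delta> \<le> DIM('a) + ln c / - ln \<delta>"
    using eventually_unit
  proof eventually_elim
    case (elim \<delta>)
    then obtain U where U: "finite U" "X \<subseteq> \<Union>U" "\<And>u. u \<in> U \<Longrightarrow> bounded u"
      "\<And>u. u \<in> U \<Longrightarrow> diameter u = \<delta>"
      "real (card U) * \<delta> ^ DIM('a) \<le> c" using c(2)[of \<delta>] by auto
    let ?C = "capacity \<delta> \<theta> DIM('a) DIM('a) X"
    have cap: "?C \<le> (\<Sum>u\<in>U. diameter u powr DIM('a)) / \<delta> powr DIM('a)" "1 \<le> ?C"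
      using capacity_le_cover[OF X(2) _ _ _ U(1,2,3), of \<delta> "real DIM('a)" "DIM('a)" \<theta>]
        U(4) elim \<theta> le_powr_if_le_one[of \<delta> \<theta>] by auto
    note cap(1)
    also have "(\<Sum>u\<in>U. diameter u powr DIM('a)) = real (card U) * \<delta> ^ DIM('a)"
      using U(4) elim by (simp add: powr_realpow)
    also have "\<dots> / \<delta> powr DIM('a) \<le> c / \<delta> powr DIM('a)" using U(5) by (rule divide_right_mono) simp
    finally have "ln ?C \<le> ln (c / \<delta> powr DIM('a))" using cap(2) c elim by (intro ln_mono) auto
    also have "\<dots> = DIM('a) * - ln \<delta> + ln c" using c elim by (simp add: ln_div ln_powr)
    finally have "cap_exponent DIM('a) \<delta> \<le> (DIM('a) * - ln \<delta> + ln c) / - ln \<delta>"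
      unfolding cap_exponent_def using elim by (intro divide_right_mono) auto
    also have "\<dots> = DIM('a) + ln c / - ln \<delta>" using elim by (simp add: field_simps)
    finally show ?case .
  qed
  ultimately show thesis by (rule that)
qed

lemma cap_exponent_nonneg: "\<forall>\<^sub>F \<delta> in at_right 0. 0 \<le> cap_exponent 0 \<delta>"
  using eventually_unit
proof eventually_elim
  case (elim \<delta>)
  hence "1 \<le> capacity \<delta> \<theta> 0 DIM('a) X" using X \<theta> by (intro capacity_ge_one) auto
  thus ?case unfolding cap_exponent_def using elim by (intro divide_nonneg_pos) auto
qed

lemma cap_exponent_mono:
  assumes "0 \<le> t" "t \<le> s" "s \<le> real DIM('a)"
  shows "\<forall>\<^sub>F \<delta> in at_right 0. cap_exponent t \<delta> \<le> cap_exponent s \<delta>"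
    and "\<forall>\<^sub>F \<delta> in at_right 0. cap_exponent s \<delta> \<le> cap_exponent t \<delta> + (1 - \<theta>) * (s - t)"
proof -
  have *: "cap_exponent t \<delta> \<le> cap_exponent s \<delta> \<and>
      cap_exponent s \<delta> \<le> cap_exponent t \<delta> + (1 - \<theta>) * (s - t)" if \<delta>: "0 < \<delta>" "\<delta> < 1" for \<delta>
  proof -
    let ?C = "\<lambda>s. capacity \<delta> \<theta> s DIM('a) X"
    define p where "p = (1 - \<theta>) * (s - t)"
    have one: "1 \<le> ?C t" "1 \<le> ?C s" using X \<theta> \<delta> assms by (auto intro!: capacity_ge_one)
    have m: "?C t \<le> ?C s" "?C s \<le> \<delta> powr - p * ?C t"
      unfolding p_def using X \<theta> \<delta> assms by (auto intro!: capacity_mono)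
    have "ln (?C t) \<le> ln (?C s)" using m one by (intro ln_mono) auto
    hence 1: "cap_exponent t \<delta> \<le> cap_exponent s \<delta>"
      unfolding cap_exponent_def using \<delta> by (intro divide_right_mono) auto
    have "ln (?C s) \<le> ln (\<delta> powr - p * ?C t)" using m one \<delta> by (intro ln_mono) auto
    also have "\<dots> = ln (?C t) + p * - ln \<delta>" using one \<delta> by (simp add: ln_mult ln_powr)
    finally have "cap_exponent s \<delta> \<le> (ln (?C t) + p * - ln \<delta>) / - ln \<delta>"
      unfolding cap_exponent_def using \<delta> by (intro divide_right_mono) auto
    also have "\<dots> = cap_exponent t \<delta> + p" using \<delta> by (simp add: cap_exponent_def field_simps)
    finally show ?thesis using 1 by (simp add: p_def)
  qed
  show "\<forall>\<^sub>F \<delta> in at_right 0. cap_exponent t \<delta> \<le> cap_exponent s \<delta>"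
    and "\<forall>\<^sub>F \<delta> in at_right 0. cap_exponent s \<delta> \<le> cap_exponent t \<delta> + (1 - \<theta>) * (s - t)"
    using eventually_unit by (eventually_elim; use * in blast)+
qed

section \<open>The equalities for nonempty sets\<close>

text \<open>Covers at arbitrarily small scales are a \<open>frequently\<close> statement, which
  matches \<open>Liminf\<close>: covers found frequently keep the lower limit at most
  \<open>s\<close>, and covers missing eventually for one \<open>\<epsilon>\<close> keep it at least
  \<open>s\<close>.\<close>

lemma lower_int_dim_eq: "lower_int_dim \<theta> X = lower_profile \<theta> DIM('a) X"
proof -
  let ?G = "at_right (0::real)"
  define F where "F s = Liminf ?G (\<lambda>\<delta>. ereal (cap_exponent s \<delta>))" for s
  define Q where "Q s \<longleftrightarrow> (\<forall>\<epsilon>>0. \<exists>\<^sub>F \<delta> in ?G. has_cover s \<epsilon> \<delta>)" for s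
  have "Inf {s. 0 \<le> s \<and> Q s} = (THE s. 0 \<le> s \<and> s \<le> real DIM('a) \<and> F s = ereal s)"
  proof (rule Inf_eq_fixed_point[where \<theta> = \<theta>])
    show "Q t" if "0 \<le> s" "s \<le> t" "Q s" for s t
      using that(3) unfolding Q_def
      by (blast intro: frequently_rev_mp eventually_mono[OF has_cover_mono[OF that(1,2)]])
    show "Q s" if "real DIM('a) < s" for s
      using has_cover_if_gt_DIM[OF that] unfolding Q_def
      by (auto intro!: eventually_frequently)
    show "F s \<le> ereal s" if s: "0 \<le> s" "s \<le> real DIM('a)" "Q s" for s
    proof (rule ccontr)
      assume "\<not> F s \<le> ereal s"
      hence "\<forall>\<^sub>F \<delta> in ?G. ereal s < ereal (cap_exponent s \<delta>)"
        unfolding F_def by (intro less_LiminfD) simp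
      with cap_exponent_le_if_has_cover[OF s(1,2)] have "\<forall>\<^sub>F \<delta> in ?G. \<not> has_cover s 1 \<delta>"
        by eventually_elim auto
      thus False using s(3) unfolding Q_def frequently_def by auto
    qed
    show "ereal s \<le> F s" if s: "0 \<le> s" "s \<le> real DIM('a)" "\<not> Q s" for s
    proof -
      obtain \<epsilon> where \<epsilon>: "\<epsilon> > 0" "\<forall>\<^sub>F \<delta> in ?G. \<not> has_cover s \<epsilon> \<delta>"
        using s(3) unfolding Q_def frequently_def by auto
      obtain err where err: "(err \<longlongrightarrow> 0) ?G"
        "\<forall>\<^sub>F \<delta> in ?G. \<not> has_cover s \<epsilon> \<delta> \<longrightarrow> s + err \<delta> \<le> cap_exponent s \<delta>"
        using cap_exponent_ge_if_not_has_cover[OF s(1,2) \<epsilon>(1)] by blast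
      have "((\<lambda>\<delta>. s + err \<delta>) \<longlongrightarrow> s + 0) ?G" by (intro tendsto_intros err)
      hence "Liminf ?G (\<lambda>\<delta>. ereal (s + err \<delta>)) = ereal s" by (intro lim_imp_Liminf) auto
      moreover have "\<forall>\<^sub>F \<delta> in ?G. ereal (s + err \<delta>) \<le> ereal (cap_exponent s \<delta>)"
        using \<epsilon>(2) err(2) by eventually_elim simp
      hence "Liminf ?G (\<lambda>\<delta>. ereal (s + err \<delta>)) \<le> F s" unfolding F_def by (rule Liminf_mono)
      ultimately show ?thesis by simp
    qed
    show "0 \<le> F 0"
      unfolding F_def using cap_exponent_nonneg by (intro Liminf_bounded) simp
    show "F (real DIM('a)) \<le> ereal (real DIM('a))"
    proof -
      obtain err where err: "(err \<longlongrightarrow> 0) ?G"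
        "\<forall>\<^sub>F \<delta> in ?G. cap_exponent DIM('a) \<delta> \<le> real DIM('a) + err \<delta>"
        using cap_exponent_DIM_le by blast
      have "((\<lambda>\<delta>. real DIM('a) + err \<delta>) \<longlongrightarrow> real DIM('a) + 0) ?G" by (intro tendsto_intros err)
      hence "Liminf ?G (\<lambda>\<delta>. ereal (real DIM('a) + err \<delta>)) = ereal (DIM('a))"
        by (intro lim_imp_Liminf) auto
      moreover have "F DIM('a) \<le> Liminf ?G (\<lambda>\<delta>. ereal (real DIM('a) + err \<delta>))"
        unfolding F_def using err(2) by (intro Liminf_mono) simp
      ultimately show ?thesis by simp
    qed
    show "F t \<le> F s" if "0 \<le> t" "t \<le> s" "s \<le> real DIM('a)" for t s
      unfolding F_def using cap_exponent_mono(1)[OF that] by (intro Liminf_mono) simp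
    show "F s \<le> F t + ereal ((1 - \<theta>) * (s - t))" if "0 \<le> t" "t \<le> s" "s \<le> real DIM('a)" for t s
    proof -
      have "F s \<le> Liminf ?G (\<lambda>\<delta>. ereal (cap_exponent t \<delta>) + ereal ((1 - \<theta>) * (s - t)))"
        unfolding F_def using cap_exponent_mono(2)[OF that] by (intro Liminf_mono) simp
      thus ?thesis by (subst (asm) Liminf_add_ereal_right) (auto simp: F_def)
    qed
  qed (use \<theta> in auto)
  moreover have "lower_int_dim \<theta> X = Inf {s. 0 \<le> s \<and> Q s}"
    unfolding lower_int_dim_def Q_def has_cover_def frequently_at_right_powr_iff[OF \<theta>(1)] ..
  ultimately show ?thesis
    unfolding lower_profile_def F_def cap_exponent_def by simp
qed

text \<open>Covers at all small scales are an \<open>eventually\<close> statement, which matches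
  \<open>Limsup\<close>. A failing \<open>\<epsilon>\<close> now gives missing covers only at
  arbitrarily small scales, which still bounds the upper limit from below.\<close>

lemma upper_int_dim_eq: "upper_int_dim \<theta> X = upper_profile \<theta> DIM('a) X"
proof -
  let ?G = "at_right (0::real)"
  define F where "F s = Limsup ?G (\<lambda>\<delta>. ereal (cap_exponent s \<delta>))" for s
  define Q where "Q s \<longleftrightarrow> (\<forall>\<epsilon>>0. \<forall>\<^sub>F \<delta> in ?G. has_cover s \<epsilon> \<delta>)" for s
  have "Inf {s. 0 \<le> s \<and> Q s} = (THE s. 0 \<le> s \<and> s \<le> real DIM('a) \<and> F s = ereal s)"
  proof (rule Inf_eq_fixed_point[where \<theta> = \<theta>])
    show "Q t" if "0 \<le> s" "s \<le> t" "Q s" for s t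
      using that(3) unfolding Q_def
      by (blast intro: eventually_rev_mp has_cover_mono[OF that(1,2)])
    show "Q s" if "real DIM('a) < s" for s
      using has_cover_if_gt_DIM[OF that] unfolding Q_def by blast
    show "F s \<le> ereal s" if s: "0 \<le> s" "s \<le> real DIM('a)" "Q s" for s
    proof -
      have "\<forall>\<^sub>F \<delta> in ?G. has_cover s 1 \<delta>" using s(3) unfolding Q_def by simp
      with cap_exponent_le_if_has_cover[OF s(1,2)]
      have "\<forall>\<^sub>F \<delta> in ?G. ereal (cap_exponent s \<delta>) \<le> ereal s" by eventually_elim simp
      thus ?thesis unfolding F_def by (rule Limsup_bounded)
    qed
    show "ereal s \<le> F s" if s: "0 \<le> s" "s \<le> real DIM('a)" "\<not> Q s" for s
    proof (rule ccontr)
      assume "\<not> ereal s \<le> F s"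
      \<comment> \<open>If the exponents were eventually below \<open>y\<close>, and so below
        \<open>s + err \<delta>\<close>, every small scale would have a cover.\<close>
      then obtain y where y: "F s < ereal y" "ereal y < ereal s"
        using ereal_dense2[of "F s" "ereal s"] by (auto simp: not_le)
      obtain \<epsilon> where \<epsilon>: "\<epsilon> > 0" "\<not> (\<forall>\<^sub>F \<delta> in ?G. has_cover s \<epsilon> \<delta>)"
        using s(3) unfolding Q_def by auto
      obtain err where err: "(err \<longlongrightarrow> 0) ?G"
        "\<forall>\<^sub>F \<delta> in ?G. \<not> has_cover s \<epsilon> \<delta> \<longrightarrow> s + err \<delta> \<le> cap_exponent s \<delta>"
        using cap_exponent_ge_if_not_has_cover[OF s(1,2) \<epsilon>(1)] by blast
      have "((\<lambda>\<delta>. s + err \<delta>) \<longlongrightarrow> s + 0) ?G" by (intro tendsto_intros err)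
      hence "\<forall>\<^sub>F \<delta> in ?G. y < s + err \<delta>" using y(2) by (intro order_tendstoD(1)) auto
      moreover have "\<forall>\<^sub>F \<delta> in ?G. ereal (cap_exponent s \<delta>) < ereal y"
        using y(1) unfolding F_def by (rule Limsup_lessD)
      ultimately have "\<forall>\<^sub>F \<delta> in ?G. has_cover s \<epsilon> \<delta>"
        using err(2) by eventually_elim force
      thus False using \<epsilon>(2) by simp
    qed
    show "0 \<le> F 0"
      unfolding F_def using cap_exponent_nonneg by (intro le_Limsup) simp_all
    show "F (real DIM('a)) \<le> ereal (real DIM('a))"
    proof -
      obtain err where err: "(err \<longlongrightarrow> 0) ?G"
        "\<forall>\<^sub>F \<delta> in ?G. cap_exponent DIM('a) \<delta> \<le> real DIM('a) + err \<delta>"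
        using cap_exponent_DIM_le by blast
      have "((\<lambda>\<delta>. real DIM('a) + err \<delta>) \<longlongrightarrow> real DIM('a) + 0) ?G" by (intro tendsto_intros err)
      hence "Limsup ?G (\<lambda>\<delta>. ereal (real DIM('a) + err \<delta>)) = ereal (DIM('a))"
        by (intro lim_imp_Limsup) auto
      moreover have "F DIM('a) \<le> Limsup ?G (\<lambda>\<delta>. ereal (real DIM('a) + err \<delta>))"
        unfolding F_def using err(2) by (intro Limsup_mono) simp
      ultimately show ?thesis by simp
    qed
    show "F t \<le> F s" if "0 \<le> t" "t \<le> s" "s \<le> real DIM('a)" for t s
      unfolding F_def using cap_exponent_mono(1)[OF that] by (intro Limsup_mono) simp
    show "F s \<le> F t + ereal ((1 - \<theta>) * (s - t))" if "0 \<le> t" "t \<le> s" "s \<le> real DIM('a)" for t s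
    proof -
      have "F s \<le> Limsup ?G (\<lambda>\<delta>. ereal (cap_exponent t \<delta>) + ereal ((1 - \<theta>) * (s - t)))"
        unfolding F_def using cap_exponent_mono(2)[OF that] by (intro Limsup_mono) simp
      thus ?thesis by (subst (asm) Limsup_add_ereal_right) (auto simp: F_def)
    qed
  qed (use \<theta> in auto)
  moreover have "upper_int_dim \<theta> X = Inf {s. 0 \<le> s \<and> Q s}"
    unfolding upper_int_dim_def Q_def has_cover_def eventually_at_right_powr_iff[OF \<theta>(1)] ..
  ultimately show ?thesis
    unfolding upper_profile_def F_def cap_exponent_def by simp
qed

end

section \<open>The empty set\<close>

text \<open>The empty family has sum 0 for every exponent, so already \<open>s = 0\<close> is
  admissible.\<close>

lemma int_dim_empty: "lower_int_dim \<theta> {} = 0" "upper_int_dim \<theta> {} = 0"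
proof -
  have cover: "int_cover {} \<theta> r s \<epsilon> {}" if "\<epsilon> > 0" for r s \<epsilon> :: real
    using that by (simp add: int_cover_def)
  show "lower_int_dim \<theta> {} = 0"
    unfolding lower_int_dim_def by (rule cInf_eq_minimum) (auto intro: cover)
  show "upper_int_dim \<theta> {} = 0"
    unfolding upper_int_dim_def by (rule cInf_eq_minimum) (auto intro!: cover exI[of _ "1::real"])
qed

text \<open>No probability measure lives on the empty set, so the capacity is \<open>inverse (enn2real \<infinity>) = 0\<close>,
  and \<open>ln 0 = 0\<close>.\<close>

lemma profile_empty:
  "lower_profile \<theta> k ({} :: 'a::euclidean_space set) = 0"
  "upper_profile \<theta> k ({} :: 'a::euclidean_space set) = 0"
proof -
  have "\<mu> \<notin> supp_prob_measures {}" for \<mu> :: "'a measure"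
  proof
    assume \<mu>: "\<mu> \<in> supp_prob_measures {}"
    interpret prob_space \<mu> using supp_prob_measuresD(1)[OF \<mu>] .
    show False using supp_prob_measuresD(4)[OF \<mu>] by simp
  qed
  hence "supp_prob_measures ({} :: 'a set) = {}" by blast
  hence "capacity r \<theta> s k ({} :: 'a set) = 0" for r s by (simp add: capacity_def)
  thus "lower_profile \<theta> k ({} :: 'a set) = 0" "upper_profile \<theta> k ({} :: 'a set) = 0"
    unfolding lower_profile_def upper_profile_def
    by (auto simp: Liminf_const Limsup_const intro!: the_equality)
qed

theorem theorem5p1:
  fixes X :: "'a::euclidean_space set" and \<theta> :: real
  assumes "bounded X" and "0 < \<theta>" and "\<theta> \<le> 1"
  shows "lower_int_dim \<theta> X = lower_profile \<theta> DIM('a) X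
       \<and> upper_int_dim \<theta> X = upper_profile \<theta> DIM('a) X"
proof (cases "X = {}")
  case True
  thus ?thesis by (simp add: int_dim_empty profile_empty)
next
  case False
  with assms show ?thesis by (simp add: lower_int_dim_eq upper_int_dim_eq)
qed

end
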